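(* The periodic broken ray transform is injective in the unit cube $[0,1]^n\subset\mathbb{R}^n$, $n\ge2$, in the class of functions $\{f\in C^n([0,1]^n): f \text{ is } n\text{-even at the boundary}\}$.
   Context: A periodic broken ray in the cube $M=[0,1]^n$ is a periodic piecewise straight path in $M$ that is a straight line in the interior and is reflected at the boundary (the whole of $\partial M$ is reflecting) according to the usual reflection law (angle of incidence equals angle of reflection). Let $\Gamma$ be the set of all periodic broken rays. The periodic broken ray transform is the map taking a continuous $f:M\to\mathbb{R}$ to the function $\gamma\mapsto\int_{\operatorname{tr}(\gamma)}f\,d\mathcal{H}^1$ on $\Gamma$, where $\operatorname{tr}(\gamma)$ is the trace (image) of $\gamma$ and $\mathcal{H}^1$ is one-dimensional Hausdorff measure. A function $f\in C^m$ is $k$-even ($k\le m$) at a subset $B$ of the boundary if $\partial_\nu^i f|_B=0$ for all odd $i\le k$, where $\partial_\nu$ is the normal derivative. *)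

theory Defs
  imports "HOL-Analysis.Analysis"
begin

text \<open>
  The normalising constant is 1, so the \<open>\<delta>\<close>-premeasure is the infimum of sums of
  diameters of countable covers. The covering sets are required to be bounded because
  \<^const>\<open>diameter\<close> is unspecified on unbounded sets.
\<close>

definition hausdorff1_pre :: "real \<Rightarrow> 'a::metric_space set \<Rightarrow> ennreal" where
  "hausdorff1_pre \<delta> A =
     (INF U \<in> {U :: nat \<Rightarrow> 'a set. A \<subseteq> (\<Union>i. U i) \<and> (\<forall>i. bounded (U i) \<and> diameter (U i) \<le> \<delta>)}.
        \<Sum>i. ennreal (diameter (U i)))"

definition hausdorff1_outer :: "'a::metric_space set \<Rightarrow> ennreal" where
  "hausdorff1_outer A = (SUP \<delta> \<in> {0<..}. hausdorff1_pre \<delta> A)"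

definition hausdorff1 :: "'a::metric_space measure" where
  "hausdorff1 = measure_of UNIV (sets borel) hausdorff1_outer"

text \<open>
  Derivatives are taken within \<open>S\<close>, hence are one-sided at boundary points of \<open>S\<close>. On a
  nondegenerate box they are unique. The direction \<open>v\<close> is fixed, so iterating
  \<open>dir_deriv S v\<close> gives the higher derivatives in direction \<open>v\<close>.
\<close>

definition dir_deriv ::
    "'a::euclidean_space set \<Rightarrow> 'a \<Rightarrow> ('a \<Rightarrow> real) \<Rightarrow> 'a \<Rightarrow> real" where
  "dir_deriv S v f x = frechet_derivative f (at x within S) v"

primrec Ck_on :: "nat \<Rightarrow> 'a::euclidean_space set \<Rightarrow> ('a \<Rightarrow> real) \<Rightarrow> bool" where
  "Ck_on 0 S f \<longleftrightarrow> continuous_on S f"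
| "Ck_on (Suc k) S f \<longleftrightarrow> f differentiable_on S \<and> (\<forall>b\<in>Basis. Ck_on k S (dir_deriv S b f))"

definition unit_cube :: "(real^'n) set" where
  "unit_cube = cbox 0 1"

text \<open>The normals of all faces through \<open>x\<close>; more than one if \<open>x\<close> lies on an edge or corner.\<close>

definition outer_normals :: "real^'n \<Rightarrow> (real^'n) set" where
  "outer_normals x = {axis i 1 |i. x $ i = 1} \<union> {- axis i 1 |i. x $ i = 0}"

text \<open>
  On a face the normal field is constant, so the \<open>i\<close>-th normal derivative is the \<open>i\<close>-th
  iterate of the derivative in the direction of that normal. At edges and corners the
  condition is imposed for each adjacent face.
\<close>

definition even_at :: "nat \<Rightarrow> (real^'n) set \<Rightarrow> (real^'n \<Rightarrow> real) \<Rightarrow> bool" where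
  "even_at k B f \<longleftrightarrow>
     (\<forall>i\<le>k. odd i \<longrightarrow> (\<forall>x\<in>B. \<forall>\<nu>\<in>outer_normals x. (dir_deriv unit_cube \<nu> ^^ i) f x = 0))"

definition reflect :: "'a::real_inner \<Rightarrow> 'a \<Rightarrow> 'a" where
  "reflect \<nu> v = v - (2 * (v \<bullet> \<nu>)) *\<^sub>R \<nu>"

definition straight_at :: "(real \<Rightarrow> real^'n) \<Rightarrow> real \<Rightarrow> bool" where
  "straight_at \<gamma> t \<longleftrightarrow>
     (\<exists>v. norm v = 1 \<and> (\<exists>\<epsilon>>0. \<forall>s. \<bar>s\<bar> < \<epsilon> \<longrightarrow> \<gamma> (t + s) = \<gamma> t + s *\<^sub>R v))"

text \<open>
  The reflection law refers to the normal of the boundary, so a reflection takes place at a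
  point lying on exactly one face.
\<close>

definition reflected_at :: "(real \<Rightarrow> real^'n) \<Rightarrow> real \<Rightarrow> bool" where
  "reflected_at \<gamma> t \<longleftrightarrow>
     (\<exists>\<nu> v. outer_normals (\<gamma> t) = {\<nu>} \<and> norm v = 1 \<and> v \<bullet> \<nu> > 0 \<and>
        (\<exists>\<epsilon>>0. \<forall>s. 0 \<le> s \<and> s < \<epsilon> \<longrightarrow>
           \<gamma> (t - s) = \<gamma> t - s *\<^sub>R v \<and> \<gamma> (t + s) = \<gamma> t + s *\<^sub>R reflect \<nu> v))"

text \<open>
  Rays are parametrised by arc length over the whole line. By compactness of a period, the local
  conditions give finitely many straight pieces per period.
\<close>

definition periodic_broken_rays :: "(real \<Rightarrow> real^'n) set" where
  "periodic_broken_rays =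
     {\<gamma>. range \<gamma> \<subseteq> unit_cube \<and> (\<exists>T>0. \<forall>t. \<gamma> (t + T) = \<gamma> t) \<and>
         (\<forall>t. \<gamma> t \<in> interior unit_cube \<longrightarrow> straight_at \<gamma> t) \<and>
         (\<forall>t. \<gamma> t \<in> frontier unit_cube \<longrightarrow> reflected_at \<gamma> t)}"

definition periodic_broken_ray_transform ::
    "(real^'n \<Rightarrow> real) \<Rightarrow> (real \<Rightarrow> real^'n) \<Rightarrow> real" where
  "periodic_broken_ray_transform f =
     (\<lambda>\<gamma>\<in>periodic_broken_rays. LINT x:range \<gamma>|hausdorff1. f x)"

end

theory Submission
  imports Defs
begin

text \<open>
  Folding every coordinate by the zigzag map, the distance to the nearest even integer, maps
  \<open>\<real>\<^sup>n\<close> onto the cube and straight lines to billiard trajectories. A line whose direction is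
  proportional to an integer vector becomes a periodic trajectory, and this trajectory is a broken
  ray unless it stays in a face or meets two faces at once (\<open>billiard_periodic_broken_ray\<close>). The
  inverse image of a function on the cube is even and has period 2 in every coordinate, so the
  problem is the injectivity of the transform that integrates functions on a flat torus over
  closed geodesics.

  Let \<open>h\<close> be the difference of two functions with the same transform. Two coordinates \<open>i\<close>, \<open>j\<close>
  suffice: fix the others at values in the open unit interval and let only the two move. This
  gives a continuous function \<open>G\<close> on the plane, even and 2-periodic in both variables, and the
  claim is \<open>G = 0\<close> (\<open>torus_even_eq_0_if_lines\<close>). For integers \<open>a\<close>, \<open>b\<close> the function
  \<open>cos (\<pi> (a x + b y))\<close> is constant along the integer direction orthogonal to \<open>(a, b)\<close>.
  Averaging the line integrals in this direction over the torus shows that \<open>G\<close> is orthogonal to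
  this function. Sums of products of cosines are dense by the Stone--Weierstrass theorem, so \<open>G\<close>
  is orthogonal to itself. Lines whose trajectory is not a broken ray form a set with dense
  complement in every direction, and their integrals are limits of integrals over broken rays
  (\<open>line_integral_eq_0_if_generic\<close>).

  The transform integrates over the trace, in which multiplicities are lost, whereas the Fourier
  argument needs integrals over the parameter. Both agree up to a constant factor. A generic
  oblique trajectory passes through all but countably many of its points once per period, because
  it could retrace itself only after running into an edge (\<open>billiard_oblique_integral\<close>). A
  trajectory parallel to a coordinate axis runs back and forth on a segment and covers it exactly
  twice (\<open>billiard_axis_integral\<close>). On a parameter set on which a piecewise isometric curve is
  injective up to countably many points, the Hausdorff measure of the image is the length of the
  parameter set (\<open>hausdorff1_curve\<close>). This rests on two facts about the Hausdorff measure: it is a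
  measure on the Borel sets (\<open>measure_space_hausdorff1_outer\<close>), and on the line it is Lebesgue
  measure (\<open>hausdorff1_outer_eq_lborel\<close>).
\<close>

section \<open>The Hausdorff measure on Borel sets\<close>

lemma hausdorff1_pre_le:
  assumes "A \<subseteq> (\<Union>i. U i)" "\<And>i. bounded (U i)" "\<And>i. diameter (U i) \<le> \<delta>"
  shows "hausdorff1_pre \<delta> A \<le> (\<Sum>i. ennreal (diameter (U i)))"
  unfolding hausdorff1_pre_def by (rule INF_lower) (use assms in auto)

lemma hausdorff1_pre_mono: "A \<subseteq> B \<Longrightarrow> hausdorff1_pre \<delta> A \<le> hausdorff1_pre \<delta> B"
  unfolding hausdorff1_pre_def by (rule INF_superset_mono) auto

lemma hausdorff1_pre_antimono: "\<delta> \<le> \<epsilon> \<Longrightarrow> hausdorff1_pre \<epsilon> A \<le> hausdorff1_pre \<delta> A"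
  unfolding hausdorff1_pre_def by (rule INF_superset_mono) (auto intro: order_trans)

lemma hausdorff1_pre_close:
  assumes "hausdorff1_pre \<delta> A < e"
  obtains U where "A \<subseteq> (\<Union>i. U i)" "\<And>i. bounded (U i)" "\<And>i. diameter (U i) \<le> \<delta>"
    "(\<Sum>i. ennreal (diameter (U i))) < e"
  using assms unfolding hausdorff1_pre_def INF_less_iff by blast

lemma hausdorff1_pre_countably_subadditive:
  "hausdorff1_pre \<delta> (\<Union>i. A i) \<le> (\<Sum>n. hausdorff1_pre \<delta> (A n))"
proof (rule ennreal_le_epsilon)
  fix e :: real
  assume "0 < e" "(\<Sum>n. hausdorff1_pre \<delta> (A n)) < top"
  then have *: "\<And>n. hausdorff1_pre \<delta> (A n) < hausdorff1_pre \<delta> (A n) + e * (1/2)^Suc n"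
    by (auto simp add: less_top dest!: ennreal_suminf_lessD)
  have "\<exists>U. A n \<subseteq> (\<Union>i. U i) \<and> (\<forall>i. bounded (U i)) \<and> (\<forall>i. diameter (U i) \<le> \<delta>) \<and>
      (\<Sum>i. ennreal (diameter (U i))) \<le> hausdorff1_pre \<delta> (A n) + e * (1/2)^Suc n" for n
    by (rule hausdorff1_pre_close[OF *[of n]]) (metis less_imp_le)
  then obtain U where U: "\<And>n. A n \<subseteq> (\<Union>i. U n i)" "\<And>n i. bounded (U n i)"
      "\<And>n i. diameter (U n i) \<le> \<delta>"
      "\<And>n. (\<Sum>i. ennreal (diameter (U n i))) \<le> hausdorff1_pre \<delta> (A n) + e * (1/2)^Suc n"
    by metis
  define C where "C = case_prod U \<circ> prod_decode"
  have "(\<Union>i. A i) \<subseteq> (\<Union>i. C i)"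
    using U(1) by (auto simp add: C_def subset_eq) (metis prod.case prod_encode_inverse)
  then have "hausdorff1_pre \<delta> (\<Union>i. A i) \<le> (\<Sum>i. ennreal (diameter (C i)))"
    by (rule hausdorff1_pre_le) (auto simp: C_def U split: prod.split)
  also have "\<dots> = (\<Sum>n. \<Sum>i. ennreal (diameter (U n i)))"
    unfolding C_def comp_def by (intro suminf_ennreal_2dimen) auto
  also have "\<dots> \<le> (\<Sum>n. hausdorff1_pre \<delta> (A n) + e * (1/2) ^ Suc n)"
    by (intro suminf_le allI U(4)) auto
  also have "\<dots> = (\<Sum>n. hausdorff1_pre \<delta> (A n)) + (\<Sum>n. ennreal e * ennreal ((1/2) ^ Suc n))"
    using \<open>0 < e\<close> by (subst suminf_add[symmetric])
       (auto simp del: ennreal_suminf_cmult simp add: ennreal_mult[symmetric])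
  also have "\<dots> = (\<Sum>n. hausdorff1_pre \<delta> (A n)) + e"
    unfolding ennreal_suminf_cmult
    by (subst suminf_ennreal_eq[OF zero_le_power power_half_series]) auto
  finally show "hausdorff1_pre \<delta> (\<Union>i. A i) \<le> (\<Sum>n. hausdorff1_pre \<delta> (A n)) + e" .
qed

lemma hausdorff1_pre_le_outer: "0 < \<delta> \<Longrightarrow> hausdorff1_pre \<delta> A \<le> hausdorff1_outer A"
  unfolding hausdorff1_outer_def by (rule SUP_upper) auto

lemma hausdorff1_outer_mono: "A \<subseteq> B \<Longrightarrow> hausdorff1_outer A \<le> hausdorff1_outer B"
  unfolding hausdorff1_outer_def by (intro SUP_mono') (rule hausdorff1_pre_mono)

lemma hausdorff1_outer_empty [simp]: "hausdorff1_outer ({} :: 'a::metric_space set) = 0"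
proof -
  have "hausdorff1_pre \<delta> ({} :: 'a set) \<le> (\<Sum>i::nat. ennreal (diameter ({}::'a set)))" if "0 < \<delta>" for \<delta>
    by (rule hausdorff1_pre_le) (use that in auto)
  then show ?thesis
    unfolding hausdorff1_outer_def by (intro antisym SUP_least) auto
qed

lemma hausdorff1_outer_countably_subadditive:
  "hausdorff1_outer (\<Union>i. A i) \<le> (\<Sum>n. hausdorff1_outer (A n))"
proof -
  have "hausdorff1_pre \<delta> (\<Union>i. A i) \<le> (\<Sum>n. hausdorff1_outer (A n))" if "0 < \<delta>" for \<delta>
    using hausdorff1_pre_countably_subadditive
    by (rule order_trans) (auto intro!: suminf_le hausdorff1_pre_le_outer that)
  then show ?thesis
    unfolding hausdorff1_outer_def[of "\<Union>i. A i"] by (intro SUP_least) auto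
qed

lemma outer_measure_space_hausdorff1_outer:
  "outer_measure_space (Pow UNIV) hausdorff1_outer"
  by (auto simp: outer_measure_space_def positive_def increasing_def countably_subadditive_def
      intro: hausdorff1_outer_mono hausdorff1_outer_countably_subadditive)

lemma hausdorff1_outer_Un: "hausdorff1_outer (A \<union> B) \<le> hausdorff1_outer A + hausdorff1_outer B"
proof -
  have "(\<Union>i. binaryset A B i) = A \<union> B" by (rule UN_binaryset_eq)
  moreover have "(\<Sum>n. hausdorff1_outer (binaryset A B n)) = hausdorff1_outer A + hausdorff1_outer B"
    by (rule suminf_binaryset_eq) simp
  ultimately show ?thesis
    by (metis hausdorff1_outer_countably_subadditive)
qed

text \<open>
  A set of diameter less than the distance of \<open>A\<close> and \<open>B\<close> meets at most one of them, so a fine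
  cover of the union splits into a cover of \<open>A\<close> and a cover of \<open>B\<close>.
\<close>

lemma hausdorff1_outer_separated:
  assumes "0 < r" and sep: "\<And>x y. x \<in> A \<Longrightarrow> y \<in> B \<Longrightarrow> r \<le> dist x y"
  shows "hausdorff1_outer A + hausdorff1_outer B \<le> hausdorff1_outer (A \<union> B)"
proof -
  have pre: "hausdorff1_pre \<delta> A + hausdorff1_pre \<delta> B \<le> hausdorff1_pre \<delta> (A \<union> B)"
    if \<delta>: "0 < \<delta>" "\<delta> < r" for \<delta>
    unfolding hausdorff1_pre_def[of \<delta> "A \<union> B"]
  proof (rule INF_greatest, clarify)
    fix U :: "nat \<Rightarrow> 'a set"
    assume cov: "A \<union> B \<subseteq> (\<Union>i. U i)" and U: "\<forall>i. bounded (U i) \<and> diameter (U i) \<le> \<delta>"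
    define V where "V C i = (if U i \<inter> C \<noteq> {} then U i else {})" for C i
    have V: "hausdorff1_pre \<delta> C \<le> (\<Sum>i. ennreal (diameter (V C i)))" if "C \<subseteq> A \<union> B" for C
    proof (rule hausdorff1_pre_le)
      show "C \<subseteq> (\<Union>i. V C i)"
      proof
        fix x assume "x \<in> C"
        then obtain i where "x \<in> U i" using cov \<open>C \<subseteq> A \<union> B\<close> by blast
        then have "x \<in> V C i" using \<open>x \<in> C\<close> by (auto simp: V_def)
        then show "x \<in> (\<Union>i. V C i)" by blast
      qed
    qed (use U \<delta> in \<open>auto simp: V_def\<close>)
    have "ennreal (diameter (V A i)) + ennreal (diameter (V B i)) \<le> ennreal (diameter (U i))" for i
    proof -
      have "U i \<inter> A = {} \<or> U i \<inter> B = {}"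
      proof (rule ccontr)
        assume "\<not> ?thesis"
        then obtain x y where "x \<in> U i" "x \<in> A" "y \<in> U i" "y \<in> B" by blast
        then have "r \<le> diameter (U i)"
          using sep[of x y] diameter_bounded_bound[of "U i" x y] U by force
        then show False using U \<delta> by (meson not_le order_trans)
      qed
      then show ?thesis by (auto simp: V_def)
    qed
    then have "(\<Sum>i. ennreal (diameter (V A i)) + ennreal (diameter (V B i)))
        \<le> (\<Sum>i. ennreal (diameter (U i)))"
      by (intro suminf_le) auto
    moreover have "hausdorff1_pre \<delta> A + hausdorff1_pre \<delta> B
        \<le> (\<Sum>i. ennreal (diameter (V A i))) + (\<Sum>i. ennreal (diameter (V B i)))"
      by (intro add_mono V) auto
    ultimately show "hausdorff1_pre \<delta> A + hausdorff1_pre \<delta> B \<le> (\<Sum>i. ennreal (diameter (U i)))"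
      by (simp add: suminf_add)
  qed
  have "hausdorff1_outer A + hausdorff1_outer B
      = (SUP \<delta>\<in>{0<..}. hausdorff1_pre \<delta> A + hausdorff1_pre \<delta> B)"
    unfolding hausdorff1_outer_def
  proof (rule SUP_add_directed_ennreal[symmetric])
    fix i j :: real
    assume "i \<in> {0<..}" "j \<in> {0<..}"
    then show "\<exists>k\<in>{0<..}. hausdorff1_pre i A + hausdorff1_pre j B \<le> hausdorff1_pre k A + hausdorff1_pre k B"
      by (intro bexI[of _ "min i j"] add_mono hausdorff1_pre_antimono) auto
  qed
  also have "\<dots> \<le> hausdorff1_outer (A \<union> B)"
  proof (rule SUP_least)
    fix \<delta> :: real
    assume "\<delta> \<in> {0<..}"
    define \<eta> where "\<eta> = min \<delta> (r/2)"
    have \<eta>: "0 < \<eta>" "\<eta> < r" "\<eta> \<le> \<delta>" using \<open>\<delta> \<in> {0<..}\<close> \<open>0 < r\<close> by (auto simp: \<eta>_def)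
    have "hausdorff1_pre \<delta> A + hausdorff1_pre \<delta> B \<le> hausdorff1_pre \<eta> A + hausdorff1_pre \<eta> B"
      by (intro add_mono hausdorff1_pre_antimono \<eta>)
    also have "\<dots> \<le> hausdorff1_pre \<eta> (A \<union> B)" by (rule pre) (use \<eta> in auto)
    also have "\<dots> \<le> hausdorff1_outer (A \<union> B)" by (rule hausdorff1_pre_le_outer) (use \<eta> in auto)
    finally show "hausdorff1_pre \<delta> A + hausdorff1_pre \<delta> B \<le> hausdorff1_outer (A \<union> B)" .
  qed
  finally show ?thesis .
qed

text \<open>
  The layers \<open>R k\<close> accumulate at the zero set of \<open>g\<close>. Two layers with an index between them are a
  positive distance apart, so the layers of one parity have total measure at most that of \<open>A\<close>.
  Hence the series of all layers converges and its tails become small.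
\<close>

lemma hausdorff1_outer_exhaust:
  fixes g :: "'a::metric_space \<Rightarrow> real"
  assumes fin: "hausdorff1_outer A < top" and lip: "\<And>x y. \<bar>g x - g y\<bar> \<le> dist x y" and "0 < e"
  obtains n :: nat where
    "hausdorff1_outer {x\<in>A. 0 < g x} \<le> hausdorff1_outer {x\<in>A. 1 / (real n + 1) \<le> g x} + ennreal e"
proof -
  define R where "R k = {x\<in>A. 1 / (real k + 2) \<le> g x \<and> g x < 1 / (real k + 1)}" for k
  define f where "f k = hausdorff1_outer (R k)" for k
  have parity: "(\<Sum>k<m. f (p + 2*k)) \<le> hausdorff1_outer (\<Union>k<m. R (p + 2*k))" for p m :: nat
  proof (induction m)
    case (Suc m)
    define r where "r = 1 / (real (p + 2*m)) - 1 / (real (p + 2*m) + 1)"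
    have "(\<Sum>k<Suc m. f (p + 2*k)) \<le> hausdorff1_outer (\<Union>k<m. R (p + 2*k)) + hausdorff1_outer (R (p + 2*m))"
      using Suc by (simp add: f_def add_mono)
    also have "\<dots> \<le> hausdorff1_outer ((\<Union>k<m. R (p + 2*k)) \<union> R (p + 2*m))"
    \<comment> \<open>For \<open>m = 0\<close> the union is empty, and \<open>r\<close> may contain a division by zero.\<close>
    proof (cases "m = 0")
      case False
      show ?thesis
      proof (rule hausdorff1_outer_separated)
        show "0 < r" using False by (auto simp: r_def intro!: divide_strict_left_mono mult_pos_pos)
        fix x y
        assume "x \<in> (\<Union>k<m. R (p + 2*k))" "y \<in> R (p + 2*m)"
        then obtain k where k: "k < m" "1 / (real (p + 2*k) + 2) \<le> g x" "g y < 1 / (real (p + 2*m) + 1)"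
          by (auto simp: R_def)
        have "real (p + 2*k) + 2 \<le> real (p + 2*m)"
          using k(1) by linarith
        then have "1 / real (p + 2*m) \<le> 1 / (real (p + 2*k) + 2)"
          by (intro divide_left_mono) (auto intro!: mult_pos_pos)
        then have "r \<le> g x - g y"
          using k by (auto simp: r_def)
        then show "r \<le> dist x y" using lip[of x y] by linarith
      qed
    qed simp
    also have "(\<Union>k<m. R (p + 2*k)) \<union> R (p + 2*m) = (\<Union>k<Suc m. R (p + 2*k))"
      by (auto simp: less_Suc_eq)
    finally show ?case .
  qed simp
  have "(\<Sum>k<n. f k) \<le> hausdorff1_outer A + hausdorff1_outer A" for n
  proof -
    have "(\<Sum>k<n. f k) \<le> (\<Sum>k<2*n. f k)"
      by (intro sum_mono2) auto
    also have "\<dots> = (\<Sum>k<n. f (0 + 2*k)) + (\<Sum>k<n. f (1 + 2*k))"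
      by (induction n) (auto simp: ac_simps)
    also have "\<dots> \<le> hausdorff1_outer (\<Union>k<n. R (0 + 2*k)) + hausdorff1_outer (\<Union>k<n. R (1 + 2*k))"
      by (intro add_mono parity)
    also have "\<dots> \<le> hausdorff1_outer A + hausdorff1_outer A"
      by (intro add_mono hausdorff1_outer_mono) (auto simp: R_def)
    finally show ?thesis .
  qed
  then have "suminf f \<le> hausdorff1_outer A + hausdorff1_outer A"
    by (intro suminf_le_const) auto
  also have "\<dots> < top" using fin by simp
  finally have sfin: "suminf f < top" .
  have "\<exists>n. suminf f < sum f {..<n} + ennreal e"
  proof (rule ccontr)
    assume "\<not> ?thesis"
    then have "(SUP n. sum f {..<n} + ennreal e) \<le> suminf f"
      by (intro SUP_least) (auto simp: not_less)
    then have "suminf f + ennreal e \<le> suminf f + 0"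
      by (simp add: ennreal_SUP_add_left suminf_eq_SUP)
    then show False
      using sfin \<open>0 < e\<close> by (subst (asm) ennreal_add_left_cancel_le) auto
  qed
  then obtain n where "suminf f < sum f {..<n} + ennreal e" by blast
  moreover have "suminf f = sum f {..<n} + (\<Sum>k. f (k + n))"
    by (subst suminf_offset[of f n]) (auto simp: add.commute)
  ultimately have tail: "(\<Sum>k. f (k + n)) < ennreal e"
    using ennreal_add_left_cancel_less by metis
  have "{x\<in>A. 0 < g x} \<subseteq> {x\<in>A. 1 / (real n + 1) \<le> g x} \<union> (\<Union>k. R (k + n))"
  proof
    fix x assume x: "x \<in> {x\<in>A. 0 < g x}"
    show "x \<in> {x\<in>A. 1 / (real n + 1) \<le> g x} \<union> (\<Union>k. R (k + n))"
    proof (cases "1 / (real n + 1) \<le> g x")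
      case False
      \<comment> \<open>The layer of \<open>x\<close> starts at the largest threshold \<open>1 / (m + 1)\<close> that \<open>g x\<close> reaches.\<close>
      define P where "P k \<longleftrightarrow> 1 / (real k + 1) \<le> g x" for k
      obtain N where "N \<noteq> 0" "inverse (real N) < g x" using x reals_Archimedean2 real_arch_inverse by blast
      then have "P N"
        unfolding P_def using frac_le[of 1 1 "real N" "real N + 1"] by (auto simp: inverse_eq_divide)
      define m where "m = (LEAST k. P k)"
      have "P m" unfolding m_def using \<open>P N\<close> by (rule LeastI)
      have "n < m"
      proof (rule ccontr)
        assume "\<not> n < m"
        then have "1 / (real n + 1) \<le> 1 / (real m + 1)" by (intro divide_left_mono) auto
        with \<open>P m\<close> False show False by (auto simp: P_def)
      qed
      then obtain k where k: "m = Suc (k + n)" by (metis add.commute less_imp_Suc_add)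
      then have "\<not> P (k + n)" using not_less_Least[of "k + n" P] by (auto simp: m_def)
      then have "x \<in> R (k + n)"
        using x \<open>P m\<close> by (auto simp: R_def P_def k add_ac not_le)
      then show ?thesis by blast
    qed (use x in auto)
  qed
  then have "hausdorff1_outer {x\<in>A. 0 < g x}
      \<le> hausdorff1_outer {x\<in>A. 1 / (real n + 1) \<le> g x} + hausdorff1_outer (\<Union>k. R (k + n))"
    by (meson hausdorff1_outer_Un hausdorff1_outer_mono order_trans)
  also have "hausdorff1_outer (\<Union>k. R (k + n)) \<le> (\<Sum>k. f (k + n))"
    unfolding f_def by (rule hausdorff1_outer_countably_subadditive)
  also note less_imp_le[OF tail]
  finally show ?thesis using that by (auto intro: add_left_mono)
qed

text \<open>
  The part of \<open>A\<close> inside \<open>C\<close> has a positive distance from the points of \<open>A\<close> at distance at least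
  \<open>1 / (n + 1)\<close> from \<open>C\<close>, so the measures of these two add up to at most that of \<open>A\<close>. As \<open>C\<close> is
  closed, and nonempty without loss of generality, \<open>A - C\<close> consists of the points of \<open>A\<close> at
  positive distance from \<open>C\<close>, and its measure is approximated by the latter sets.
\<close>

lemma closed_in_lambda_system:
  assumes "closed C"
  shows "C \<in> lambda_system UNIV (Pow UNIV) hausdorff1_outer"
proof -
  have "hausdorff1_outer (C \<inter> A) + hausdorff1_outer ((UNIV - C) \<inter> A) \<le> hausdorff1_outer A" for A
  proof (cases "C = {} \<or> hausdorff1_outer A = top")
    case False
    then have fin: "hausdorff1_outer A < top" by (simp add: less_top)
    have diff: "(UNIV - C) \<inter> A = {x\<in>A. 0 < infdist x C}"
      using in_closed_iff_infdist_zero[OF assms] False infdist_nonneg[of _ C]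
      by (auto simp: order_less_le)
    show ?thesis
    proof (rule ennreal_le_epsilon)
      fix e :: real
      assume "0 < e"
      obtain n :: nat where n: "hausdorff1_outer {x\<in>A. 0 < infdist x C}
          \<le> hausdorff1_outer {x\<in>A. 1 / (real n + 1) \<le> infdist x C} + ennreal e"
        using hausdorff1_outer_exhaust[OF fin infdist_triangle_abs \<open>0 < e\<close>] .
      have "hausdorff1_outer (C \<inter> A) + hausdorff1_outer {x\<in>A. 1 / (real n + 1) \<le> infdist x C}
          \<le> hausdorff1_outer (C \<inter> A \<union> {x\<in>A. 1 / (real n + 1) \<le> infdist x C})"
      proof (rule hausdorff1_outer_separated)
        fix x y
        assume "x \<in> C \<inter> A" "y \<in> {x\<in>A. 1 / (real n + 1) \<le> infdist x C}"
        then show "1 / (real n + 1) \<le> dist x y"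
          using infdist_le[of x C y] by (auto simp: dist_commute)
      qed simp
      also have "\<dots> \<le> hausdorff1_outer A"
        by (rule hausdorff1_outer_mono) auto
      finally have "hausdorff1_outer (C \<inter> A) + hausdorff1_outer {x\<in>A. 1 / (real n + 1) \<le> infdist x C}
          + ennreal e \<le> hausdorff1_outer A + ennreal e"
        by (rule add_right_mono)
      then show "hausdorff1_outer (C \<inter> A) + hausdorff1_outer ((UNIV - C) \<inter> A) \<le> hausdorff1_outer A + ennreal e"
        unfolding diff using add_left_mono[OF n, of "hausdorff1_outer (C \<inter> A)"]
        by (simp only: add.assoc)
    qed
  qed auto
  moreover have "hausdorff1_outer A \<le> hausdorff1_outer (C \<inter> A) + hausdorff1_outer ((UNIV - C) \<inter> A)" for A
    using hausdorff1_outer_Un[of "C \<inter> A" "(UNIV - C) \<inter> A"]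
    by (metis Int_Un_distrib2 Un_Diff_cancel Un_UNIV_right Int_UNIV_left)
  ultimately show ?thesis
    by (auto simp: lambda_system_def intro: antisym)
qed

text \<open>
  This is what makes \<^const>\<open>hausdorff1\<close> meaningful: \<^const>\<open>measure_of\<close> returns the zero measure
  unless the given set function is countably additive on the \<open>\<sigma>\<close>-algebra.
\<close>

lemma measure_space_hausdorff1_outer:
  "measure_space UNIV (sets (borel :: 'a::metric_space measure)) hausdorff1_outer"
proof -
  let ?L = "lambda_system (UNIV :: 'a set) (Pow UNIV) hausdorff1_outer"
  interpret P: sigma_algebra "UNIV :: 'a set" "Pow UNIV" by (rule sigma_algebra_Pow)
  have ms: "measure_space UNIV ?L hausdorff1_outer"
    by (rule P.caratheodory_lemma[OF outer_measure_space_hausdorff1_outer])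
  then interpret L: sigma_algebra "UNIV :: 'a set" ?L by (simp add: measure_space_def)
  have "U \<in> ?L" if "open U" for U
  proof -
    have "UNIV - (UNIV - U) \<in> ?L"
      using that by (intro L.compl_sets closed_in_lambda_system) (auto simp flip: Compl_eq_Diff_UNIV)
    then show ?thesis by (simp add: double_diff)
  qed
  then have "sigma_sets UNIV {S :: 'a set. open S} \<subseteq> ?L"
    by (intro L.sigma_sets_subset) auto
  then have "sets (borel :: 'a measure) \<subseteq> ?L"
    by (simp add: borel_def)
  then show ?thesis
    using measure_down[OF ms] sets.sigma_algebra_axioms[of "borel :: 'a measure"] by simp
qed

lemma sets_hausdorff1 [simp, measurable_cong]: "sets hausdorff1 = sets borel"
  unfolding hausdorff1_def by (metis sets.sets_measure_of_eq space_borel)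

lemma space_hausdorff1 [simp]: "space hausdorff1 = UNIV"
  unfolding hausdorff1_def by (simp add: space_measure_of_conv)

lemma emeasure_hausdorff1: "A \<in> sets borel \<Longrightarrow> emeasure hausdorff1 A = hausdorff1_outer A"
  unfolding hausdorff1_def using measure_space_hausdorff1_outer
  by (intro emeasure_measure_of_sigma) (auto simp: measure_space_def)

section \<open>Length of piecewise isometric curves\<close>

lemma diameter_le_metric:
  fixes S :: "'a::metric_space set"
  assumes "0 \<le> d" "\<And>x y. x \<in> S \<Longrightarrow> y \<in> S \<Longrightarrow> dist x y \<le> d"
  shows "diameter S \<le> d"
  using assms by (auto simp: diameter_def intro!: cSUP_least)

text \<open>
  The image of a cover of \<open>E\<close>, each set cut down to \<open>E\<close>, is a cover of the image by sets that are no
  larger.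
\<close>

lemma hausdorff1_outer_lipschitz_image:
  fixes g :: "'a::metric_space \<Rightarrow> 'b::metric_space"
  assumes lip: "\<And>x y. x \<in> E \<Longrightarrow> y \<in> E \<Longrightarrow> dist (g x) (g y) \<le> dist x y"
  shows "hausdorff1_outer (g ` E) \<le> hausdorff1_outer E"
proof -
  have "hausdorff1_pre \<delta> (g ` E) \<le> hausdorff1_pre \<delta> E" for \<delta>
    unfolding hausdorff1_pre_def[of \<delta> E]
  proof (rule INF_greatest, clarify)
    fix U :: "nat \<Rightarrow> 'a set"
    assume cov: "E \<subseteq> (\<Union>i. U i)" and U: "\<forall>i. bounded (U i) \<and> diameter (U i) \<le> \<delta>"
    define V where "V i = g ` (U i \<inter> E)" for i
    have d: "dist x y \<le> diameter (U i)" if xy: "x \<in> V i" "y \<in> V i" for x y i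
    proof -
      obtain x' y' where "x' \<in> U i" "x' \<in> E" "y' \<in> U i" "y' \<in> E" "x = g x'" "y = g y'"
        using xy unfolding V_def by blast
      then show ?thesis
        using lip[of x' y'] diameter_bounded_bound[of "U i" x' y'] U by auto
    qed
    have dV: "diameter (V i) \<le> diameter (U i)" for i
      using U by (intro diameter_le_metric diameter_ge_0 d) auto
    have "hausdorff1_pre \<delta> (g ` E) \<le> (\<Sum>i. ennreal (diameter (V i)))"
    proof (rule hausdorff1_pre_le)
      show "g ` E \<subseteq> (\<Union>i. V i)" using cov unfolding V_def by blast
      show "bounded (V i)" for i unfolding bounded_two_points using d by blast
      show "diameter (V i) \<le> \<delta>" for i using dV[of i] U by (meson order_trans)
    qed
    also have "\<dots> \<le> (\<Sum>i. ennreal (diameter (U i)))"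
      by (intro suminf_le allI ennreal_leI dV) auto
    finally show "hausdorff1_pre \<delta> (g ` E) \<le> (\<Sum>i. ennreal (diameter (U i)))" .
  qed
  then show ?thesis
    unfolding hausdorff1_outer_def by (intro SUP_mono') auto
qed

lemma hausdorff1_outer_isometric_image:
  fixes g :: "'a::metric_space \<Rightarrow> 'b::metric_space"
  assumes iso: "\<And>x y. x \<in> E \<Longrightarrow> y \<in> E \<Longrightarrow> dist (g x) (g y) = dist x y"
  shows "hausdorff1_outer (g ` E) = hausdorff1_outer E"
proof (rule antisym)
  show "hausdorff1_outer (g ` E) \<le> hausdorff1_outer E"
    by (rule hausdorff1_outer_lipschitz_image) (simp add: iso)
  have "inj_on g E" by (rule inj_onI) (metis iso dist_eq_0_iff)
  then have "hausdorff1_outer E = hausdorff1_outer (inv_into E g ` g ` E)" by simp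
  also have "\<dots> \<le> hausdorff1_outer (g ` E)"
    by (rule hausdorff1_outer_lipschitz_image) (auto simp: \<open>inj_on g E\<close> iso)
  finally show "hausdorff1_outer E \<le> hausdorff1_outer (g ` E)" .
qed

text \<open>
  A bounded set of real numbers lies in an interval whose length is the diameter of the set.
\<close>

lemma lborel_le_hausdorff1_outer:
  assumes [measurable]: "E \<in> sets borel"
  shows "emeasure lborel (E :: real set) \<le> hausdorff1_outer E"
proof -
  have "emeasure lborel E \<le> hausdorff1_pre 1 E"
    unfolding hausdorff1_pre_def
  proof (rule INF_greatest, clarify)
    fix U :: "nat \<Rightarrow> real set"
    assume cov: "E \<subseteq> (\<Union>i. U i)" and U: "\<forall>i. bounded (U i) \<and> diameter (U i) \<le> 1"
    have "\<exists>a. U i \<subseteq> {a..a + diameter (U i)}" for i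
    proof (cases "U i = {}")
      case False
      have bd: "bdd_below (U i)" using U by (auto intro: bounded_imp_bdd_below)
      have "x \<le> Inf (U i) + diameter (U i)" if "x \<in> U i" for x
      proof -
        have "x - diameter (U i) \<le> Inf (U i)"
        proof (rule cInf_greatest[OF False])
          fix y assume "y \<in> U i"
          then show "x - diameter (U i) \<le> y"
            using diameter_bounded_bound[of "U i" x y] that U by (auto simp: dist_real_def)
        qed
        then show ?thesis by simp
      qed
      then show ?thesis using cInf_lower[OF _ bd] by (intro exI[of _ "Inf (U i)"]) auto
    qed auto
    then obtain a where a: "\<And>i. U i \<subseteq> {a i..a i + diameter (U i)}" by metis
    have "emeasure lborel E \<le> emeasure lborel (\<Union>i. {a i..a i + diameter (U i)})"
      using cov a by (intro emeasure_mono sets.countable_UN) (blast, auto)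
    also have "\<dots> \<le> (\<Sum>i. emeasure lborel {a i..a i + diameter (U i)})"
      by (rule emeasure_subadditive_countably) auto
    also have "\<dots> = (\<Sum>i. ennreal (diameter (U i)))"
      using U by (intro suminf_cong) (auto simp: diameter_ge_0)
    finally show "emeasure lborel E \<le> (\<Sum>i. ennreal (diameter (U i)))" .
  qed
  also have "\<dots> \<le> hausdorff1_outer E" by (rule hausdorff1_pre_le_outer) simp
  finally show ?thesis .
qed

lemma hausdorff1_outer_Icc_le:
  assumes "a \<le> b"
  shows "hausdorff1_outer {a..b::real} \<le> ennreal (b - a)"
proof -
  have "hausdorff1_pre \<delta> {a..b} \<le> ennreal (b - a)" if \<delta>: "0 < \<delta>" for \<delta>
  proof -
    obtain N :: nat where N: "N \<noteq> 0" "(b - a) / \<delta> < real N"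
      using reals_Archimedean2[of "(b - a) / \<delta>"] assms \<delta>
      by (metis diff_ge_0_iff_ge divide_nonneg_pos not_less of_nat_0)
    define h where "h = (b - a) / real N"
    have h: "0 \<le> h" "h \<le> \<delta>" "real N * h = b - a"
      using N assms that by (auto simp: h_def field_simps)
    define U where "U i = (if i < N then {a + real i * h..a + real (Suc i) * h} else {})" for i
    have dU: "diameter (U i) = (if i < N then h else 0)" for i
      using h(1) by (auto simp: U_def algebra_simps)
    have "{a..b} \<subseteq> (\<Union>i. U i)"
    proof
      fix x assume x: "x \<in> {a..b}"
      show "x \<in> (\<Union>i. U i)"
      proof (cases "x = b")
        case True
        obtain M where M: "N = Suc M" using N(1) not0_implies_Suc by blast
        then have "x \<in> U M" using True h by (auto simp: U_def algebra_simps)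
        then show ?thesis by blast
      next
        case False
        then have "0 < h" using x h assms N by (auto simp: h_def)
        define i where "i = nat \<lfloor>(x - a) / h\<rfloor>"
        have ri: "real i = of_int \<lfloor>(x - a) / h\<rfloor>" using x \<open>0 < h\<close> by (auto simp: i_def)
        have i: "real i \<le> (x - a) / h" "(x - a) / h < real i + 1"
          unfolding ri by linarith+
        then have i': "a + real i * h \<le> x" "x < a + (real i + 1) * h"
          using \<open>0 < h\<close> by (auto simp: field_simps)
        have "real i * h < real N * h" using i'(1) x False h(3) by auto
        then have "i < N" using \<open>0 < h\<close> by simp
        then have "x \<in> U i" using i' by (auto simp: U_def add.commute)
        then show ?thesis by blast
      qed
    qed
    then have "hausdorff1_pre \<delta> {a..b} \<le> (\<Sum>i. ennreal (diameter (U i)))"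
      by (rule hausdorff1_pre_le) (auto simp: dU h that less_imp_le, auto simp: U_def)
    also have "\<dots> = (\<Sum>i<N. ennreal (diameter (U i)))"
      by (rule suminf_finite) (auto simp: dU)
    also have "\<dots> = (\<Sum>i<N. ennreal h)" by (rule sum.cong) (auto simp: dU)
    also have "\<dots> = ennreal (b - a)"
      using h by (simp add: ennreal_of_nat_eq_real_of_nat ennreal_mult[symmetric])
    finally show ?thesis .
  qed
  then show ?thesis unfolding hausdorff1_outer_def by (intro SUP_least) auto
qed

text \<open>
  Both measures give \<open>{a..b}\<close> the length \<open>b - a\<close>, and one of them is dominated by the other. The
  domination on the complement of \<open>E\<close> in the interval is the reverse estimate on \<open>E\<close>.
\<close>

lemma hausdorff1_outer_eq_lborel:
  assumes [measurable]: "E \<in> sets borel" and E: "E \<subseteq> {a..b::real}"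
  shows "hausdorff1_outer E = emeasure lborel E"
proof (cases "a \<le> b")
  case True
  have H: "emeasure hausdorff1 X = hausdorff1_outer X" if "X \<in> sets borel" for X :: "real set"
    using that by (rule emeasure_hausdorff1)
  have split: "emeasure M {a..b} = emeasure M E + emeasure M ({a..b} - E)"
    if "sets M = sets borel" for M
    using plus_emeasure[of E M "{a..b} - E"] E that by (simp add: Un_absorb1)
  have "hausdorff1_outer E + emeasure lborel ({a..b} - E) \<le> emeasure hausdorff1 E + emeasure hausdorff1 ({a..b} - E)"
    by (simp add: H lborel_le_hausdorff1_outer add_left_mono)
  also have "\<dots> = hausdorff1_outer {a..b}" using split[of hausdorff1] by (simp add: H)
  also have "\<dots> \<le> emeasure lborel {a..b}" using hausdorff1_outer_Icc_le[OF True] True by simp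
  also have "\<dots> = emeasure lborel E + emeasure lborel ({a..b} - E)" by (rule split) simp
  finally have le: "emeasure lborel ({a..b} - E) + hausdorff1_outer E \<le> emeasure lborel ({a..b} - E) + emeasure lborel E"
    by (simp add: add.commute)
  have "emeasure lborel ({a..b} - E) \<le> emeasure lborel {a..b}" by (rule emeasure_mono) auto
  also have "\<dots> < top" using True by simp
  finally have "hausdorff1_outer E \<le> emeasure lborel E"
    using le by (auto simp: ennreal_add_left_cancel_le)
  then show ?thesis using lborel_le_hausdorff1_outer[of E] by (intro antisym) auto
qed (use E in auto)

lemma hausdorff1_outer_countable:
  assumes "countable N"
  shows "hausdorff1_outer (N :: 'a::metric_space set) = 0"
proof (cases "N = {}")
  case False
  have sing: "hausdorff1_outer {x :: 'a} = 0" for x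
  proof -
    have "hausdorff1_pre \<delta> {x} \<le> (\<Sum>i::nat. ennreal (diameter {x}))" if "0 < \<delta>" for \<delta>
      by (rule hausdorff1_pre_le) (use that in auto)
    then show ?thesis unfolding hausdorff1_outer_def by (intro antisym SUP_least) auto
  qed
  have "N = (\<Union>i. {from_nat_into N i})"
    using range_from_nat_into[OF False assms] by auto
  then have "hausdorff1_outer N \<le> (\<Sum>i. hausdorff1_outer {from_nat_into N i})"
    by (metis hausdorff1_outer_countably_subadditive)
  then show ?thesis by (simp add: sing)
qed simp

text \<open>
  Away from a countable set the images of the pieces are disjoint, and each piece is mapped
  isometrically, so the measure of the image is the total length of the parameter set.
\<close>

lemma hausdorff1_curve:
  fixes \<gamma> :: "real \<Rightarrow> 'a::metric_space" and P :: "'i::countable \<Rightarrow> real set"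
  assumes cont: "continuous_on UNIV \<gamma>"
    and A: "{a..b} = (\<Union>i. P i)" and P: "\<And>i. closed (P i)"
    and iso: "\<And>i s t. s \<in> P i \<Longrightarrow> t \<in> P i \<Longrightarrow> dist (\<gamma> s) (\<gamma> t) = dist s t"
    and N: "countable N" and inj: "inj_on \<gamma> ({a..b} - N)"
    and over: "\<And>i j. i \<noteq> j \<Longrightarrow> P i \<inter> P j \<subseteq> N"
    and B: "B \<in> sets borel"
  shows "emeasure hausdorff1 (B \<inter> \<gamma> ` {a..b}) = emeasure lborel ({a..b} \<inter> \<gamma> -` B)"
proof -
  have meas: "\<gamma> \<in> borel_measurable borel" using cont by (rule borel_measurable_continuous_onI)
  \<comment> \<open>Removing the countable set \<open>C\<close> makes the images of the pieces disjoint.\<close>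
  define C where "C = \<gamma> ` N"
  have cC: "countable C" using N by (simp add: C_def)
  have Csets: "X \<in> sets borel" if "countable X" for X :: "'b::metric_space set"
    using that by (rule borel_closed[THEN sets.countable[of _ borel], rotated]) simp
  have pre: "\<gamma> -` X \<in> sets borel" if "X \<in> sets borel" for X
    using measurable_sets_borel[OF meas that] .
  have Pcomp: "compact (P i)" for i
    using P[of i] A by (metis UN_upper UNIV_I bounded_closed_interval bounded_subset compact_eq_bounded_closed)
  have Pimg: "\<gamma> ` P i \<in> sets borel" for i
    by (intro borel_compact compact_continuous_image Pcomp continuous_on_subset[OF cont]) auto
  have Psets: "P i \<in> sets borel" for i using P by (rule borel_closed)
  have Psub: "P i \<subseteq> {a..b}" for i using A by blast
  define H where "H i = B \<inter> \<gamma> ` P i - C" for i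
  define L where "L i = P i \<inter> \<gamma> -` (B - C)" for i
  have Hsets: "H i \<in> sets borel" for i unfolding H_def by (intro sets.Diff sets.Int B Pimg Csets cC)
  have Lsets: "L i \<in> sets borel" for i unfolding L_def by (intro sets.Int Psets pre sets.Diff B Csets cC)
  have HL: "H i = \<gamma> ` L i" for i by (auto simp: H_def L_def)
  have LN: "L i \<subseteq> {a..b} - N" for i using Psub[of i] by (auto simp: L_def C_def)
  have disL: "disjoint_family L"
  proof (unfold disjoint_family_on_def, intro ballI impI)
    fix i j :: 'i assume "i \<noteq> j"
    then show "L i \<inter> L j = {}" using over[of i j] LN[of i] by (auto simp: L_def)
  qed
  have disH: "disjoint_family H"
    unfolding disjoint_family_on_def HL
    using disL inj_on_image_Int[OF inj LN LN] by (metis disjoint_family_onD image_empty UNIV_I)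
  have eq: "emeasure hausdorff1 (H i) = emeasure lborel (L i)" for i
  proof -
    have "emeasure hausdorff1 (H i) = hausdorff1_outer (\<gamma> ` L i)"
      using Hsets[of i] unfolding HL by (rule emeasure_hausdorff1)
    also have "\<dots> = hausdorff1_outer (L i)"
      by (rule hausdorff1_outer_isometric_image) (auto simp: L_def intro: iso)
    also have "\<dots> = emeasure lborel (L i)"
      by (rule hausdorff1_outer_eq_lborel[OF Lsets]) (use LN in blast)
    finally show ?thesis .
  qed
  have "emeasure hausdorff1 (B \<inter> \<gamma> ` {a..b}) = emeasure hausdorff1 (B \<inter> \<gamma> ` {a..b} - C)"
  proof (rule emeasure_Diff_null_set[symmetric])
    show "C \<in> null_sets hausdorff1"
      by (simp add: null_sets_def Csets cC emeasure_hausdorff1 hausdorff1_outer_countable)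
    have "\<gamma> ` {a..b} \<in> sets borel"
      by (intro borel_compact compact_continuous_image continuous_on_subset[OF cont]) auto
    then show "B \<inter> \<gamma> ` {a..b} \<in> sets hausdorff1" using B by simp
  qed
  also have "B \<inter> \<gamma> ` {a..b} - C = (\<Union>i. H i)" by (auto simp: H_def A)
  also have "emeasure hausdorff1 (\<Union>i. H i) = (\<integral>\<^sup>+i. emeasure hausdorff1 (H i) \<partial>count_space UNIV)"
    by (rule emeasure_UN_countable) (auto simp: Hsets disH)
  also have "\<dots> = (\<integral>\<^sup>+i. emeasure lborel (L i) \<partial>count_space UNIV)" by (simp add: eq)
  also have "\<dots> = emeasure lborel (\<Union>i. L i)"
    by (rule emeasure_UN_countable[symmetric]) (auto simp: Lsets disL)
  also have "(\<Union>i. L i) = {a..b} \<inter> \<gamma> -` B - (\<Union>i. P i \<inter> \<gamma> -` C)" by (auto simp: L_def A)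
  also have "emeasure lborel \<dots> = emeasure lborel ({a..b} \<inter> \<gamma> -` B)"
  proof (rule emeasure_Diff_null_set)
    have "countable (P i \<inter> \<gamma> -` C)" for i
    proof (rule countable_image_inj_on)
      show "countable (\<gamma> ` (P i \<inter> \<gamma> -` C))" using cC by (rule countable_subset[rotated]) auto
      show "inj_on \<gamma> (P i \<inter> \<gamma> -` C)"
        by (rule inj_onI) (metis Int_iff iso dist_eq_0_iff dist_self)
    qed
    then have c: "countable (\<Union>i. P i \<inter> \<gamma> -` C)" by (intro countable_UN) auto
    then show "(\<Union>i. P i \<inter> \<gamma> -` C) \<in> null_sets lborel"
      by (simp add: null_sets_def Csets emeasure_lborel_countable)
    show "{a..b} \<inter> \<gamma> -` B \<in> sets lborel" using pre[OF B] by simp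
  qed
  finally show ?thesis .
qed

text \<open>
  By the preceding lemma the Hausdorff measure on the curve is the image under \<open>\<gamma>\<close> of Lebesgue
  measure on the parameter interval.
\<close>

lemma set_integral_hausdorff1_curve:
  fixes \<gamma> :: "real \<Rightarrow> 'a::metric_space" and P :: "'i::countable \<Rightarrow> real set" and f :: "'a \<Rightarrow> real"
  assumes cont: "continuous_on UNIV \<gamma>"
    and A: "{a..b} = (\<Union>i. P i)" and P: "\<And>i. closed (P i)"
    and iso: "\<And>i s t. s \<in> P i \<Longrightarrow> t \<in> P i \<Longrightarrow> dist (\<gamma> s) (\<gamma> t) = dist s t"
    and N: "countable N" and inj: "inj_on \<gamma> ({a..b} - N)"
    and over: "\<And>i j. i \<noteq> j \<Longrightarrow> P i \<inter> P j \<subseteq> N"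
    and f: "continuous_on (\<gamma> ` {a..b}) f"
  shows "(LINT x:\<gamma> ` {a..b}|hausdorff1. f x) = integral {a..b} (\<lambda>t. f (\<gamma> t))"
proof -
  let ?K = "\<gamma> ` {a..b}"
  have meas[measurable]: "\<gamma> \<in> borel_measurable borel" using cont by (rule borel_measurable_continuous_onI)
  have K: "compact ?K" by (intro compact_continuous_image continuous_on_subset[OF cont]) auto
  have Kb[measurable]: "?K \<in> sets borel" using K by (rule borel_compact)
  define g where "g x = indicator ?K x *\<^sub>R f x" for x
  have g[measurable]: "g \<in> borel_measurable borel"
    unfolding g_def using Kb f by (rule borel_measurable_continuous_on_indicator)
  have pm: "density hausdorff1 (indicator ?K) = distr (density lborel (indicator {a..b})) borel \<gamma>"
  proof (rule measure_eqI)
    fix B assume "B \<in> sets (density hausdorff1 (indicator ?K))"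
    then have [measurable]: "B \<in> sets borel" by simp
    have "emeasure (density hausdorff1 (indicator ?K)) B = emeasure hausdorff1 (B \<inter> ?K)"
      by (subst emeasure_density) (auto simp: Int_commute simp flip: nn_integral_indicator indicator_inter_arith)
    also have "\<dots> = emeasure lborel ({a..b} \<inter> \<gamma> -` B)"
      by (rule hausdorff1_curve[OF cont A P iso N inj over]) auto
    also have "\<dots> = emeasure (density lborel (indicator {a..b})) (\<gamma> -` B)"
      using measurable_sets_borel[OF meas, of B]
      by (subst emeasure_density) (auto simp flip: nn_integral_indicator indicator_inter_arith)
    also have "\<dots> = emeasure (distr (density lborel (indicator {a..b})) borel \<gamma>) B"
      by (subst emeasure_distr) auto
    finally show "emeasure (density hausdorff1 (indicator ?K)) B
        = emeasure (distr (density lborel (indicator {a..b})) borel \<gamma>) B" .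
  qed simp
  have ind: "(\<lambda>x. ennreal (indicator S x)) = indicator S" for S :: "'c set"
    by (auto simp: fun_eq_iff split: split_indicator)
  have "(LINT x:?K|hausdorff1. f x) = integral\<^sup>L hausdorff1 (\<lambda>x. indicator ?K x *\<^sub>R g x)"
    unfolding set_lebesgue_integral_def by (rule Bochner_Integration.integral_cong) (auto simp: g_def split: split_indicator)
  also have "\<dots> = integral\<^sup>L (density hausdorff1 (indicator ?K)) g"
    using integral_density[of g hausdorff1 "indicator ?K"] by (simp add: ind)
  also have "\<dots> = integral\<^sup>L (density lborel (indicator {a..b})) (\<lambda>t. g (\<gamma> t))"
    unfolding pm by (rule integral_distr) auto
  also have "\<dots> = integral\<^sup>L lborel (\<lambda>t. indicator {a..b} t *\<^sub>R g (\<gamma> t))"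
    using integral_density[of "\<lambda>t. g (\<gamma> t)" lborel "indicator {a..b}"] by (simp add: ind)
  also have "\<dots> = (LINT t:{a..b}|lborel. f (\<gamma> t))"
    unfolding set_lebesgue_integral_def
    by (rule Bochner_Integration.integral_cong) (auto simp: g_def split: split_indicator)
  also have "\<dots> = integral {a..b} (\<lambda>t. f (\<gamma> t))"
    by (intro set_borel_integral_eq_integral borel_integrable_atLeastAtMost' continuous_on_compose2[OF f]
        continuous_on_subset[OF cont]) auto
  finally show ?thesis .
qed

section \<open>Billiard trajectories by folding straight lines\<close>

text \<open>
  The distance to the nearest even integer. In this form continuity, periodicity, symmetry and the
  description of the fibres are inherited from the cosine.
\<close>

definition zigzag :: "real \<Rightarrow> real" where
  "zigzag t = arccos (cos (pi * t)) / pi"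

lemma zigzag_eq_abs:
  assumes "\<bar>t - 2 * of_int k\<bar> \<le> 1"
  shows "zigzag t = \<bar>t - 2 * of_int k\<bar>"
proof -
  have "cos (pi * t) = cos (pi * (t - 2 * of_int k))"
    using cos_int_2pin[of k] sin_int_2pin[of k] by (simp add: right_diff_distrib cos_diff mult_ac)
  also have "\<dots> = cos (pi * \<bar>t - 2 * of_int k\<bar>)"
    using cos_abs_real[of "pi * (t - 2 * of_int k)"] by (simp add: abs_mult)
  finally show ?thesis
    using assms by (simp add: zigzag_def arccos_cos mult_le_cancel_left1)
qed

lemma near_even_int: "\<exists>k. \<bar>t - 2 * of_int k\<bar> \<le> (1::real)"
proof
  show "\<bar>t - 2 * of_int \<lfloor>(t + 1) / 2\<rfloor>\<bar> \<le> 1"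
    using floor_correct[of "(t + 1) / 2"] by (simp add: abs_le_iff field_simps)
qed

lemma zigzag_nonneg: "0 \<le> zigzag t" and zigzag_le_1: "zigzag t \<le> 1"
  using near_even_int[of t] zigzag_eq_abs by fastforce+

lemma zigzag_id: "0 \<le> t \<Longrightarrow> t \<le> 1 \<Longrightarrow> zigzag t = t"
  using zigzag_eq_abs[of t 0] by auto

lemma zigzag_add_2 [simp]: "zigzag (t + 2) = zigzag t"
  by (simp add: zigzag_def distrib_left cos_add mult.commute[of pi 2])

lemma zigzag_eq_iff:
  "zigzag s = zigzag t \<longleftrightarrow> (\<exists>k::int. s - t = 2 * of_int k \<or> s + t = 2 * of_int k)"
proof -
  have "zigzag s = zigzag t \<longleftrightarrow> cos (pi * s) = cos (pi * t)"
    by (auto simp: zigzag_def dest: arccos_eq_iff[THEN iffD1, rotated])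
  also have "\<dots> \<longleftrightarrow> (\<exists>n\<in>\<int>. pi * s = pi * t + 2 * n * pi \<or> pi * s = - (pi * t) + 2 * n * pi)"
    by (rule cos_eq)
  also have "\<dots> \<longleftrightarrow> (\<exists>k::int. s - t = 2 * of_int k \<or> s + t = 2 * of_int k)"
  proof -
    have 1: "pi * s = pi * t + 2 * n * pi \<longleftrightarrow> s - t = 2 * n" for n
    proof -
      have "pi * s = pi * t + 2 * n * pi \<longleftrightarrow> pi * s = pi * (t + 2 * n)" by (simp add: algebra_simps)
      then show ?thesis by (auto simp: mult_cancel_left)
    qed
    have 2: "pi * s = - (pi * t) + 2 * n * pi \<longleftrightarrow> s + t = 2 * n" for n
    proof -
      have "pi * s = - (pi * t) + 2 * n * pi \<longleftrightarrow> pi * s = pi * (2 * n - t)" by (simp add: algebra_simps)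
      then show ?thesis by (auto simp: mult_cancel_left)
    qed
    show ?thesis unfolding 1 2 by (auto elim!: Ints_cases) 
  qed
  finally show ?thesis .
qed

lemma continuous_on_zigzag [continuous_intros]:
  fixes f :: "'a::t2_space \<Rightarrow> real"
  shows "continuous_on S f \<Longrightarrow> continuous_on S (\<lambda>x. zigzag (f x))"
  unfolding zigzag_def by (auto intro!: continuous_intros)

lemma zigzag_isometric:
  assumes "of_int m \<le> s" "s \<le> of_int m + 1" "of_int m \<le> t" "t \<le> of_int m + 1"
  shows "\<bar>zigzag s - zigzag t\<bar> = \<bar>s - t\<bar>"
proof -
  have "\<exists>k. m = 2 * k \<or> m = 2 * k - 1" by presburger
  then obtain k where k: "m = 2 * k \<or> m = 2 * k - 1" ..
  then have "zigzag s = \<bar>s - 2 * of_int k\<bar>" "zigzag t = \<bar>t - 2 * of_int k\<bar>"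
    using assms by (auto intro!: zigzag_eq_abs)
  then show ?thesis using k assms by auto
qed

lemma zigzag_near_nonint:
  assumes "t \<notin> \<int>"
  obtains \<sigma> :: real and e where "\<bar>\<sigma>\<bar> = 1" "0 < e" "\<And>s. \<bar>s\<bar> < e \<Longrightarrow> zigzag (t + s) = zigzag t + \<sigma> * s"
proof -
  obtain k where k: "\<bar>t - 2 * of_int k\<bar> \<le> 1" using near_even_int by blast
  have "t \<noteq> of_int j" for j using assms by auto
  from this[of "2 * k"] this[of "2 * k + 1"] this[of "2 * k - 1"]
  have t: "t - 2 * of_int k \<noteq> 0" "\<bar>t - 2 * of_int k\<bar> < 1" using k by auto
  define e where "e = min \<bar>t - 2 * of_int k\<bar> (1 - \<bar>t - 2 * of_int k\<bar>)"
  show ?thesis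
  proof
    show "\<bar>sgn (t - 2 * of_int k)\<bar> = 1" using t by (simp add: abs_sgn_eq)
    show "0 < e" using t by (auto simp: e_def)
    fix s assume "\<bar>s\<bar> < e"
    then show "zigzag (t + s) = zigzag t + sgn (t - 2 * of_int k) * s"
      using zigzag_eq_abs[of t k] zigzag_eq_abs[of "t + s" k] t
      by (auto simp: e_def sgn_if abs_if split: if_splits)
  qed
qed

lemma zigzag_near_int:
  obtains \<sigma> :: real where "\<bar>\<sigma>\<bar> = 1" "zigzag (of_int m) = (if \<sigma> = 1 then 0 else 1)"
    "\<And>s. \<bar>s\<bar> \<le> 1 \<Longrightarrow> zigzag (of_int m + s) = zigzag (of_int m) + \<sigma> * \<bar>s\<bar>"
proof -
  have "\<exists>k. m = 2 * k \<or> m = 2 * k + 1" by presburger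
  then obtain k where "m = 2 * k \<or> m = 2 * k + 1" ..
  then show ?thesis
  proof
    assume m: "m = 2 * k"
    show ?thesis
    proof (rule that[of 1])
      show "zigzag (of_int m) = (if (1::real) = 1 then 0 else 1)"
        using zigzag_eq_abs[of "of_int m" k] m by simp
      then show "zigzag (of_int m + s) = zigzag (of_int m) + 1 * \<bar>s\<bar>" if "\<bar>s\<bar> \<le> 1" for s
        using zigzag_eq_abs[of "of_int m + s" k] m that by simp
    qed simp
  next
    assume m: "m = 2 * k + 1"
    show ?thesis
    proof (rule that[of "-1"])
      show 1: "zigzag (of_int m) = (if (-1::real) = 1 then 0 else 1)"
        using zigzag_eq_abs[of "of_int m" k] m by simp
      show "zigzag (of_int m + s) = zigzag (of_int m) + (-1) * \<bar>s\<bar>" if "\<bar>s\<bar> \<le> 1" for s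
        using zigzag_eq_abs[of "of_int m + s" k] zigzag_eq_abs[of "of_int m + s" "k + 1"] m that 1
        by (cases "s \<le> 0") auto
    qed simp
  qed
qed

lemma zigzag_in_01_iff: "zigzag t \<in> {0, 1} \<longleftrightarrow> t \<in> \<int>"
proof
  assume "zigzag t \<in> {0, 1}"
  then have "zigzag t = zigzag 0 \<or> zigzag t = zigzag 1" by (auto simp: zigzag_id)
  then obtain k :: int where "t = 2 * of_int k \<or> t = 2 * of_int k + 1 \<or> t = 2 * of_int k - 1"
    unfolding zigzag_eq_iff by (auto simp: algebra_simps)
  then have "\<exists>j::int. t = of_int j"
    by (metis of_int_add of_int_diff of_int_mult of_int_1 of_int_numeral)
  then show "t \<in> \<int>" by auto
next
  assume "t \<in> \<int>"
  then show "zigzag t \<in> {0, 1}" using zigzag_near_int by (metis Ints_cases insertI1 insertI2)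
qed

text \<open>
  A straight line in the unfolded space, folded back into the cube coordinate by coordinate.
\<close>

definition billiard :: "real^'n \<Rightarrow> real^'n \<Rightarrow> real \<Rightarrow> real^'n" where
  "billiard x w t = (\<chi> l. zigzag (x $ l + t * w $ l))"

lemma billiard_nth [simp]: "billiard x w t $ l = zigzag (x $ l + t * w $ l)"
  by (simp add: billiard_def)

lemma continuous_on_billiard: "continuous_on S (billiard x w)"
  unfolding billiard_def by (intro continuous_intros)

lemma billiard_in_unit_cube: "billiard x w t \<in> unit_cube"
  by (simp add: unit_cube_def mem_box_cart zigzag_nonneg zigzag_le_1)

lemma norm_eq_if_abs_components_eq:
  fixes v w :: "real^'n"
  assumes "\<And>l. \<bar>v $ l\<bar> = \<bar>w $ l\<bar>"
  shows "norm v = norm w"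
  unfolding norm_vec_def L2_set_def using assms by simp

lemma uniform_neighbourhood:
  fixes P :: "'n::finite \<Rightarrow> real \<Rightarrow> bool"
  assumes "\<And>l. \<exists>e>0. \<forall>s. \<bar>s\<bar> < e \<longrightarrow> P l s"
  shows "\<exists>e>0. \<forall>s. \<bar>s\<bar> < e \<longrightarrow> (\<forall>l. P l s)"
proof -
  obtain e where e: "\<And>l. e l > 0" "\<And>l s. \<bar>s\<bar> < e l \<Longrightarrow> P l s" using assms by metis
  have "\<bar>s\<bar> < e l" if "\<bar>s\<bar> < Min (range e)" for s l
    using that by (simp add: less_le_trans)
  then show ?thesis
    using e by (intro exI[of _ "Min (range e)"]) auto
qed

lemma billiard_local:
  assumes "x $ l + t * w $ l \<notin> \<int>"
  shows "\<exists>\<sigma>::real. \<bar>\<sigma>\<bar> = 1 \<and> (\<exists>e>0. \<forall>s. \<bar>s\<bar> < e \<longrightarrow>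
    billiard x w (t + s) $ l = billiard x w t $ l + s * (\<sigma> * w $ l))"
proof -
  obtain \<sigma> :: real and e where \<sigma>: "\<bar>\<sigma>\<bar> = 1" "0 < e"
    "\<And>s. \<bar>s\<bar> < e \<Longrightarrow> zigzag (x $ l + t * w $ l + s) = zigzag (x $ l + t * w $ l) + \<sigma> * s"
    using zigzag_near_nonint[OF assms] by metis
  have "\<forall>s. \<bar>s\<bar> < e / (\<bar>w $ l\<bar> + 1) \<longrightarrow>
    billiard x w (t + s) $ l = billiard x w t $ l + s * (\<sigma> * w $ l)"
  proof (intro allI impI)
    fix s :: real assume s: "\<bar>s\<bar> < e / (\<bar>w $ l\<bar> + 1)"
    have "\<bar>s * w $ l\<bar> \<le> \<bar>s\<bar> * (\<bar>w $ l\<bar> + 1)" by (simp add: abs_mult mult_left_mono)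
    also have "\<dots> < e" using s by (simp add: pos_less_divide_eq)
    finally show "billiard x w (t + s) $ l = billiard x w t $ l + s * (\<sigma> * w $ l)"
      using \<sigma>(3)[of "s * w $ l"] by (simp add: algebra_simps)
  qed
  then show ?thesis using \<sigma>(1,2) by (intro exI[of _ \<sigma>] conjI exI[of _ "e / (\<bar>w $ l\<bar> + 1)"]) auto
qed

lemma billiard_straight_at:
  assumes "norm w = 1" and "\<And>l. x $ l + t * w $ l \<notin> \<int>"
  shows "straight_at (billiard x w) t"
proof -
  obtain \<sigma> :: "'a \<Rightarrow> real" where \<sigma>: "\<And>l. \<bar>\<sigma> l\<bar> = 1" and
    loc: "\<And>l. \<exists>e>0. \<forall>s. \<bar>s\<bar> < e \<longrightarrow>
      billiard x w (t + s) $ l = billiard x w t $ l + s * (\<sigma> l * w $ l)"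
    using billiard_local[OF assms(2)] by metis
  define v where "v = (\<chi> l. \<sigma> l * w $ l)"
  have "norm v = 1" using norm_eq_if_abs_components_eq[of v w] \<sigma> assms(1) by (simp add: v_def abs_mult)
  moreover obtain e where "e > 0" "\<And>s l. \<bar>s\<bar> < e \<Longrightarrow>
      billiard x w (t + s) $ l = billiard x w t $ l + s * (\<sigma> l * w $ l)"
    using uniform_neighbourhood[of "\<lambda>l s. billiard x w (t + s) $ l = billiard x w t $ l + s * (\<sigma> l * w $ l)", OF loc]
    by metis
  then have "\<exists>e>0. \<forall>s. \<bar>s\<bar> < e \<longrightarrow> billiard x w (t + s) = billiard x w t + s *\<^sub>R v"
    by (intro exI[of _ e]) (simp add: vec_eq_iff v_def)
  ultimately show ?thesis unfolding straight_at_def by blast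
qed

text \<open>
  At an integer value the zigzag map has a corner, so there the velocity in coordinate \<open>i\<close> changes
  its sign while all other velocities are kept. This is the reflection law, since the normal of the
  face is a multiple of the \<open>i\<close>-th basis vector.
\<close>

lemma billiard_reflected_at:
  assumes w: "norm w = 1" "w $ i \<noteq> 0" and i: "x $ i + t * w $ i \<in> \<int>"
    and other: "\<And>l. l \<noteq> i \<Longrightarrow> x $ l + t * w $ l \<notin> \<int>"
  shows "reflected_at (billiard x w) t"
proof -
  obtain m where m: "x $ i + t * w $ i = of_int m" using i by (auto elim: Ints_cases)
  obtain \<tau> :: real where \<tau>: "\<bar>\<tau>\<bar> = 1" "zigzag (of_int m) = (if \<tau> = 1 then 0 else 1)"
    "\<And>s. \<bar>s\<bar> \<le> 1 \<Longrightarrow> zigzag (of_int m + s) = zigzag (of_int m) + \<tau> * \<bar>s\<bar>"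
    using zigzag_near_int by metis
  have "\<forall>l. \<exists>\<sigma>::real. \<bar>\<sigma>\<bar> = 1 \<and> (l \<noteq> i \<longrightarrow> (\<exists>e>0. \<forall>s. \<bar>s\<bar> < e \<longrightarrow>
      billiard x w (t + s) $ l = billiard x w t $ l + s * (\<sigma> * w $ l)))"
    using billiard_local[OF other] by (metis abs_1)
  then obtain \<sigma> :: "'a \<Rightarrow> real" where \<sigma>: "\<And>l. \<bar>\<sigma> l\<bar> = 1" and
    loc: "\<And>l. l \<noteq> i \<Longrightarrow> \<exists>e>0. \<forall>s. \<bar>s\<bar> < e \<longrightarrow>
      billiard x w (t + s) $ l = billiard x w t $ l + s * (\<sigma> l * w $ l)"
    by metis
  \<comment> \<open>The slope \<open>\<tau>\<close> behind the corner is 1 on the face where coordinate \<open>i\<close> is 0, and the outer normal points against it.\<close>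
  define \<nu> where "\<nu> = (- \<tau>) *\<^sub>R axis i (1::real)"
  define v where "v = (\<chi> l. if l = i then - \<tau> * \<bar>w $ i\<bar> else \<sigma> l * w $ l)"
  have \<nu>_nth: "\<nu> $ l = (if l = i then - \<tau> else 0)" for l by (simp add: \<nu>_def axis_def)
  have v\<nu>: "v \<bullet> \<nu> = \<bar>w $ i\<bar>"
  proof -
    have "v \<bullet> \<nu> = (\<Sum>l\<in>UNIV. if l = i then \<tau> * \<tau> * \<bar>w $ i\<bar> else 0)"
      unfolding inner_vec_def by (rule sum.cong) (auto simp: \<nu>_nth v_def)
    also have "\<dots> = \<bar>w $ i\<bar>" using \<tau>(1) by (auto simp: abs_if split: if_splits)
    finally show ?thesis .
  qed
  have nv: "norm v = 1"
    using norm_eq_if_abs_components_eq[of v w] \<sigma> \<tau>(1) w(1) by (simp add: v_def abs_mult)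
  have refl: "reflect \<nu> v $ l = (if l = i then \<tau> * \<bar>w $ i\<bar> else \<sigma> l * w $ l)" for l
    unfolding reflect_def v\<nu> by (simp add: \<nu>_nth) (simp add: v_def)
  have normals: "outer_normals (billiard x w t) = {\<nu>}"
  proof -
    have "billiard x w t $ l \<noteq> 0" "billiard x w t $ l \<noteq> 1" if "l \<noteq> i" for l
      using zigzag_in_01_iff[of "x $ l + t * w $ l"] other[OF that] by auto
    then have "billiard x w t $ l = 0 \<longleftrightarrow> l = i \<and> \<tau> = 1" "billiard x w t $ l = 1 \<longleftrightarrow> l = i \<and> \<tau> \<noteq> 1" for l
      using m \<tau>(2) by (cases "l = i"; simp)+
    then have "outer_normals (billiard x w t) = {axis i 1 |i'. i' = i \<and> \<tau> \<noteq> 1} \<union> {- axis i 1 |i'. i' = i \<and> \<tau> = 1}"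
      unfolding outer_normals_def by auto
    then show ?thesis using \<tau>(1) by (auto simp: \<nu>_def abs_if split: if_splits)
  qed
  have hit: "\<exists>e>0. \<forall>s. \<bar>s\<bar> < e \<longrightarrow> billiard x w (t + s) $ l =
      billiard x w t $ l + (if l = i then \<bar>s\<bar> * (\<tau> * \<bar>w $ i\<bar>) else s * (\<sigma> l * w $ l))" for l
  proof (cases "l = i")
    case True
    have "billiard x w (t + s) $ i = billiard x w t $ i + \<bar>s\<bar> * (\<tau> * \<bar>w $ i\<bar>)" if "\<bar>s\<bar> < 1 / \<bar>w $ i\<bar>" for s
    proof -
      have "\<bar>s * w $ i\<bar> \<le> 1" using that w(2) by (simp add: abs_mult pos_less_divide_eq less_imp_le)
      moreover have "x $ i + (t + s) * w $ i = of_int m + s * w $ i" using m by (simp add: algebra_simps)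
      ultimately show ?thesis
        unfolding billiard_nth m using \<tau>(3)[of "s * w $ i"] by (simp add: abs_mult mult.left_commute)
    qed
    then show ?thesis using True w(2) by (intro exI[of _ "1 / \<bar>w $ i\<bar>"]) auto
  qed (use loc in auto)
  obtain e where e: "e > 0" "\<And>s l. \<bar>s\<bar> < e \<Longrightarrow> billiard x w (t + s) $ l =
      billiard x w t $ l + (if l = i then \<bar>s\<bar> * (\<tau> * \<bar>w $ i\<bar>) else s * (\<sigma> l * w $ l))"
    using uniform_neighbourhood[of "\<lambda>l s. billiard x w (t + s) $ l = billiard x w t $ l +
      (if l = i then \<bar>s\<bar> * (\<tau> * \<bar>w $ i\<bar>) else s * (\<sigma> l * w $ l))", OF hit] by blast
  have "billiard x w (t - s) = billiard x w t - s *\<^sub>R v \<and>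
      billiard x w (t + s) = billiard x w t + s *\<^sub>R reflect \<nu> v" if "0 \<le> s" "s < e" for s
    using e(2)[of s] e(2)[of "- s"] that by (simp add: vec_eq_iff refl) (simp add: v_def)
  then show ?thesis
    unfolding reflected_at_def using normals nv v\<nu> w(2) e(1)
    by (intro exI[of _ \<nu>] exI[of _ v] conjI exI[of _ e]) auto
qed

text \<open>
  A coordinate of the unfolded line that is an integer corresponds to a face of the cube. Hence
  \<open>fixed\<close> says that the trajectory does not run inside a face, and \<open>corner\<close> that it does not meet two
  faces at the same time.
\<close>

lemma billiard_periodic_broken_ray:
  assumes w: "norm w = 1" and T: "0 < T" "\<And>l. \<exists>k::int. T * w $ l = 2 * of_int k"
    and fixed: "\<And>l. w $ l = 0 \<Longrightarrow> x $ l \<notin> \<int>"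
    and corner: "\<And>t i j. x $ i + t * w $ i \<in> \<int> \<Longrightarrow> x $ j + t * w $ j \<in> \<int> \<Longrightarrow> i = j"
  shows "billiard x w \<in> periodic_broken_rays"
proof -
  have "billiard x w (t + T) = billiard x w t" for t
  proof (unfold vec_eq_iff, intro allI)
    fix l
    obtain k :: int where "T * w $ l = 2 * of_int k" using T(2) by blast
    then show "billiard x w (t + T) $ l = billiard x w t $ l"
      unfolding billiard_nth zigzag_eq_iff by (intro exI[of _ k]) (simp add: algebra_simps)
  qed
  moreover have "straight_at (billiard x w) t" if "billiard x w t \<in> interior unit_cube" for t
  proof (rule billiard_straight_at[OF w])
    fix l
    have "0 < billiard x w t $ l" "billiard x w t $ l < 1"
      using that by (auto simp: unit_cube_def interior_cbox mem_box_cart)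
    then show "x $ l + t * w $ l \<notin> \<int>"
      using zigzag_in_01_iff[of "x $ l + t * w $ l"] by auto
  qed
  moreover have "reflected_at (billiard x w) t" if "billiard x w t \<in> frontier unit_cube" for t
  proof -
    have "billiard x w t \<notin> interior unit_cube" using that by (simp add: frontier_def)
    then obtain i where "\<not> (0 < billiard x w t $ i \<and> billiard x w t $ i < 1)"
      by (auto simp: unit_cube_def interior_cbox mem_box_cart)
    then have "zigzag (x $ i + t * w $ i) \<in> {0, 1}"
      using zigzag_nonneg[of "x $ i + t * w $ i"] zigzag_le_1[of "x $ i + t * w $ i"] by auto
    then have i: "x $ i + t * w $ i \<in> \<int>" by (simp only: zigzag_in_01_iff)
    show ?thesis
    proof (rule billiard_reflected_at[OF w _ i])
      show "w $ i \<noteq> 0" using i fixed[of i] by auto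
      show "x $ l + t * w $ l \<notin> \<int>" if "l \<noteq> i" for l using corner[OF i] that by blast
    qed
  qed
  ultimately show ?thesis
    unfolding periodic_broken_rays_def using T(1) billiard_in_unit_cube by blast
qed

section \<open>Functions on the torus with vanishing line integrals\<close>

definition periodic2 :: "(real \<Rightarrow> 'a) \<Rightarrow> bool" where
  "periodic2 g \<longleftrightarrow> (\<forall>x. g (x + 2) = g x)"

lemma periodic2_add_int:
  assumes "periodic2 g"
  shows "g (x + 2 * of_int k) = g x"
proof -
  have nat: "g (y + 2 * real n) = g y" for y n
  proof (induction n)
    case (Suc n)
    have "g (y + 2 * real (Suc n)) = g (y + 2 * real n + 2)" by (simp add: algebra_simps)
    then show ?case using assms Suc by (simp add: periodic2_def)
  qed simp
  show ?thesis
    using nat[of x "nat k"] nat[of "x + 2 * of_int k" "nat (- k)"] by (cases "0 \<le> k") auto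
qed

lemma integral_periodic2_shift:
  fixes g :: "real \<Rightarrow> real"
  assumes cont: "continuous_on UNIV g" and per: "periodic2 g"
  shows "integral {0..2} (\<lambda>t. g (t + c)) = integral {0..2} g"
proof -
  have int: "g integrable_on {a..b}" for a b
    by (intro integrable_continuous_interval continuous_on_subset[OF cont]) auto
  define k where "k = \<lfloor>c / 2\<rfloor>"
  define d where "d = c - 2 * of_int k"
  have d: "0 \<le> d" "d \<le> 2" unfolding d_def k_def by linarith+
  have shift: "integral {a..b} (\<lambda>t. g (t + e)) = integral {a + e..b + e} g" for a b e
    using integral_shift_Icc_real[of a b g e] by (simp add: o_def add.commute)
  have "integral {0..2} (\<lambda>t. g (t + c)) = integral {0..2} (\<lambda>t. g (t + d))"
    using periodic2_add_int[OF per, of "_ + d" k] by (simp add: d_def add.assoc)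
  also have "\<dots> = integral {d..2 + d} g" using shift[of 0 2 d] by simp
  also have "\<dots> = integral {d..2} g + integral {2..2 + d} g"
    using d by (intro Henstock_Kurzweil_Integration.integral_combine[symmetric] int) auto
  also have "integral {2..2 + d} g = integral {0..d} (\<lambda>t. g (t + 2))"
    using shift[of 0 d 2] by (simp add: add.commute)
  also have "\<dots> = integral {0..d} g" using per by (simp add: periodic2_def)
  also have "integral {d..2} g + integral {0..d} g = integral {0..2} g"
    using Henstock_Kurzweil_Integration.integral_combine[of 0 d 2 g] d int by (simp add: add.commute)
  finally show ?thesis .
qed

text \<open>
  The integral over the torus is invariant under translations, so it equals its average over all
  translates in direction \<open>(p, q)\<close>. After an exchange of integrals this average is an integral of
  line integrals.
\<close>

lemma double_integral_eq_0_if_lines: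
  fixes W :: "real \<Rightarrow> real \<Rightarrow> real"
  assumes cont: "continuous_on UNIV (\<lambda>(x, y). W x y)"
    and per: "\<And>y. periodic2 (\<lambda>x. W x y)" "\<And>x. periodic2 (W x)"
    and line: "\<And>x y. integral {0..2} (\<lambda>t. W (x + t * p) (y + t * q)) = 0"
  shows "integral {0..2} (\<lambda>x. integral {0..2} (W x)) = 0"
proof -
  have contc: "continuous_on S (\<lambda>z. W (u z) (v z))"
    if "continuous_on S u" "continuous_on S v" for S and u v :: "'b::topological_space \<Rightarrow> real"
    using continuous_on_compose2[OF cont, of S "\<lambda>z. (u z, v z)"] that by (auto intro: continuous_on_Pair)
  have contI: "continuous_on U (\<lambda>z. integral {0..2} (\<lambda>s. W (u z s) (v z s)))"
    if "continuous_on (U \<times> {0..2}) (\<lambda>(z, s). u z s)" "continuous_on (U \<times> {0..2}) (\<lambda>(z, s). v z s)"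
    for U and u v :: "'b::topological_space \<Rightarrow> real \<Rightarrow> real"
    using integral_continuous_on_param[of U 0 2 "\<lambda>z s. W (u z s) (v z s)"]
      contc[of "U \<times> {0..2}" "\<lambda>(z, s). u z s" "\<lambda>(z, s). v z s"] that
    by (auto simp: case_prod_unfold)
  define I where "I = integral {0..2} (\<lambda>x. integral {0..2} (W x))"
  have "integral {0..2} (\<lambda>x. integral {0..2} (\<lambda>y. W (x + t * p) (y + t * q))) = I" for t
  proof -
    have "integral {0..2} (\<lambda>y. W (x + t * p) (y + t * q)) = integral {0..2} (W (x + t * p))" for x
      by (rule integral_periodic2_shift) (auto intro!: contc continuous_intros per)
    moreover have "integral {0..2} (\<lambda>x. integral {0..2} (W (x + t * p))) = I"
      unfolding I_def
    proof (rule integral_periodic2_shift)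
      show "continuous_on UNIV (\<lambda>x. integral {0..2} (W x))"
        by (rule contI) (auto intro!: continuous_intros simp: case_prod_unfold)
      show "periodic2 (\<lambda>x. integral {0..2} (W x))"
        using per(1) by (simp add: periodic2_def cong: integral_cong)
    qed
    ultimately show ?thesis by simp
  qed
  then have "2 * I = integral {0..2} (\<lambda>t. integral {0..2} (\<lambda>x. integral {0..2} (\<lambda>y. W (x + t * p) (y + t * q))))"
    by simp
  also have "\<dots> = integral {0..2} (\<lambda>x. integral {0..2} (\<lambda>t. integral {0..2} (\<lambda>y. W (x + t * p) (y + t * q))))"
  proof -
    have "continuous_on (cbox (0, 0) (2, 2)) (\<lambda>(t, x). integral {0..2} (\<lambda>y. W (x + t * p) (y + t * q)))"
      unfolding case_prod_unfold
      by (rule contI) (auto intro!: continuous_intros simp: case_prod_unfold)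
    from integral_swap_continuous[OF this] show ?thesis by simp
  qed
  also have "\<dots> = integral {0..2} (\<lambda>x. integral {0..2} (\<lambda>y. integral {0..2} (\<lambda>t. W (x + t * p) (y + t * q))))"
  proof -
    have "continuous_on (cbox (0, 0) (2, 2)) (\<lambda>(t, y). W (x + t * p) (y + t * q))" for x
      unfolding case_prod_unfold by (auto intro!: contc continuous_intros)
    from integral_swap_continuous[OF this] show ?thesis by simp
  qed
  also have "\<dots> = 0" by (simp add: line)
  finally show ?thesis by (simp add: I_def)
qed

text \<open>
  Linear combinations of products of cosines. By the product-to-sum formula they form a ring.
\<close>

inductive_set cosine_sums :: "(real \<times> real \<Rightarrow> real) set" where
  cos_cos: "(\<lambda>z. cos (pi * (of_int a * fst z)) * cos (pi * (of_int b * snd z))) \<in> cosine_sums"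
| add: "g \<in> cosine_sums \<Longrightarrow> h \<in> cosine_sums \<Longrightarrow> (\<lambda>z. g z + h z) \<in> cosine_sums"
| scale: "g \<in> cosine_sums \<Longrightarrow> (\<lambda>z. c * g z) \<in> cosine_sums"

lemma continuous_on_cosine_sums: "g \<in> cosine_sums \<Longrightarrow> continuous_on S g"
  by (induction rule: cosine_sums.induct) (auto intro!: continuous_intros)

lemma cosine_sums_mult:
  assumes "g \<in> cosine_sums" "h \<in> cosine_sums"
  shows "(\<lambda>z. g z * h z) \<in> cosine_sums"
  using assms(2)
proof (induction rule: cosine_sums.induct)
  case (cos_cos a b)
  show ?case using assms(1)
  proof (induction rule: cosine_sums.induct)
    case (cos_cos c d)
    let ?B = "\<lambda>a b z. cos (pi * (of_int a * fst z)) * cos (pi * (of_int b * snd z)) :: real"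
    have "(\<lambda>z. ?B c d z * ?B a b z) = (\<lambda>z. 1/4 * (((?B (c - a) (d - b) z + ?B (c - a) (d + b) z)
        + ?B (c + a) (d - b) z) + ?B (c + a) (d + b) z))"
      by (simp add: fun_eq_iff algebra_simps cos_add cos_diff)
    then show ?case
      by (simp only:) (intro cosine_sums.intros)
  next
    case (add g h)
    from cosine_sums.add[OF add.IH] show ?case by (simp add: distrib_right)
  next
    case (scale g c)
    from cosine_sums.scale[OF scale.IH, of c] show ?case by (simp add: mult.assoc)
  qed
next
  case (add g' h')
  from cosine_sums.add[OF add.IH] show ?case by (simp add: distrib_left)
next
  case (scale g' c)
  from cosine_sums.scale[OF scale.IH, of c] show ?case by (simp add: mult.left_commute)
qed

text \<open>
  The Stone--Weierstrass theorem applies because \<open>cos (\<pi> t)\<close> is injective on the unit interval.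
\<close>

lemma cosine_sums_dense:
  fixes G :: "real \<times> real \<Rightarrow> real"
  assumes "continuous_on (cbox (0, 0) (1, 1)) G" "0 < e"
  obtains g where "g \<in> cosine_sums" "\<And>z. z \<in> cbox (0, 0) (1, 1) \<Longrightarrow> \<bar>G z - g z\<bar> < e"
proof -
  interpret function_ring_on cosine_sums "cbox (0, 0) (1, 1) :: (real \<times> real) set"
  proof
    show "(\<lambda>_. c) \<in> cosine_sums" for c
      using cosine_sums.scale[OF cosine_sums.cos_cos[of 0 0], of c] by simp
    fix x y :: "real \<times> real"
    assume xy: "x \<in> cbox (0, 0) (1, 1)" "y \<in> cbox (0, 0) (1, 1)" "x \<noteq> y"
    have inj: "s = t" if "cos (pi * s) = cos (pi * t)" "0 \<le> s" "s \<le> 1" "0 \<le> t" "t \<le> 1" for s t :: real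
      using cos_inj_pi[of "pi * s" "pi * t"] that by auto
    show "\<exists>f\<in>cosine_sums. f x \<noteq> f y"
    proof (rule ccontr)
      assume "\<not> ?thesis"
      then have "cos (pi * fst x) = cos (pi * fst y)" "cos (pi * snd x) = cos (pi * snd y)"
        using cosine_sums.cos_cos[of 1 0] cosine_sums.cos_cos[of 0 1] by fastforce+
      then have "fst x = fst y" "snd x = snd y"
        using xy by (auto intro!: inj simp: cbox_Pair_eq mem_Times_iff)
      with \<open>x \<noteq> y\<close> show False by (auto simp: prod_eq_iff)
    qed
  qed (rule compact_cbox continuous_on_cosine_sums cosine_sums.add cosine_sums_mult; assumption?)+
  show ?thesis using Stone_Weierstrass_basic[OF assms] that by blast
qed

text \<open>
  Invariance under folding means evenness and period 2 in both variables. In this form, a value at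
  any point is visibly a value on the unit square.
\<close>

definition torus_even :: "(real \<times> real \<Rightarrow> 'a) \<Rightarrow> bool" where
  "torus_even G \<longleftrightarrow> (\<forall>x y. G (x, y) = G (zigzag x, zigzag y))"

lemma torus_even_periodic:
  assumes "torus_even G"
  shows "periodic2 (\<lambda>x. G (x, y))" "periodic2 (\<lambda>y. G (x, y))"
  using assms unfolding torus_even_def periodic2_def by (metis zigzag_add_2)+

lemma torus_even_cosine_sums: "g \<in> cosine_sums \<Longrightarrow> torus_even g"
proof (induction rule: cosine_sums.induct)
  case (cos_cos a b)
  have "cos (pi * (of_int a * zigzag x)) = cos (pi * (of_int a * x))" for a :: int and x
  proof -
    obtain k :: int where "zigzag x - x = 2 * of_int k \<or> zigzag x + x = 2 * of_int k"
      using zigzag_eq_iff[of "zigzag x" x] zigzag_id zigzag_nonneg zigzag_le_1 by blast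
    then have "pi * (of_int a * zigzag x) = pi * (of_int a * x) + 2 * of_int (a * k) * pi
        \<or> pi * (of_int a * zigzag x) = - (pi * (of_int a * x)) + 2 * of_int (a * k) * pi"
    proof
      assume "zigzag x - x = 2 * of_int k"
      then have z: "zigzag x = x + 2 * of_int k" by simp
      show ?thesis unfolding z by (simp add: algebra_simps)
    next
      assume "zigzag x + x = 2 * of_int k"
      then have z: "zigzag x = 2 * of_int k - x" by simp
      show ?thesis unfolding z by (simp add: algebra_simps)
    qed
    then show ?thesis unfolding cos_eq by (metis Ints_of_int)
  qed
  then show ?case by (simp add: torus_even_def)
qed (auto simp: torus_even_def)

text \<open>
  A character \<open>cos (\<pi> (a x + b y))\<close> is constant on the lines in direction \<open>(b, - a)\<close>, so multiplying
  \<open>G\<close> by it keeps the line integrals zero, and \<open>G\<close> is orthogonal to it. Products of two cosines are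
  averages of two characters. Approximating \<open>G\<close> by their linear combinations \<open>g\<close> bounds the
  integral of \<open>G\<^sup>2\<close>, which is that of \<open>G (G - g)\<close>, by any positive number.

  Directions parallel to an axis are stated separately, with one sign only, since the corresponding
  trajectories are of a different kind.
\<close>

lemma torus_even_eq_0_if_lines:
  fixes G :: "real \<times> real \<Rightarrow> real"
  assumes cont: "continuous_on UNIV G" and even: "torus_even G"
    and oblique: "\<And>x y p q. coprime p q \<Longrightarrow> p \<noteq> 0 \<Longrightarrow> q \<noteq> 0 \<Longrightarrow>
      integral {0..2} (\<lambda>t. G (x + t * of_int p, y + t * of_int q)) = 0"
    and horizontal: "\<And>x y. integral {0..2} (\<lambda>t. G (x + t, y)) = 0"
    and vertical: "\<And>x y. integral {0..2} (\<lambda>t. G (x, y + t)) = 0"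
  shows "G z = 0"
proof -
  let ?Q = "cbox (0, 0) (2, 2) :: (real \<times> real) set"
  have contS: "continuous_on S G" for S using cont by (rule continuous_on_subset) simp
  have character: "integral ?Q (\<lambda>z. G z * cos (pi * (of_int a * fst z + of_int b * snd z))) = 0" for a b :: int
  proof -
    define W where "W x y = G (x, y) * cos (pi * (of_int a * x + of_int b * y))" for x y
    have cos_per: "cos (pi * (of_int c * (x + 2) + d)) = cos (pi * (of_int c * x + d))" for c :: int and x d
    proof -
      have "pi * (of_int c * (x + 2) + d) = pi * (of_int c * x + d) + 2 * of_int c * pi"
        by (simp add: algebra_simps)
      then show ?thesis unfolding cos_eq by (metis Ints_of_int)
    qed
    have contW: "continuous_on UNIV (\<lambda>(x, y). W x y)"
      unfolding W_def case_prod_unfold by (auto intro!: continuous_intros cont)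
    have per: "periodic2 (\<lambda>x. W x y)" "periodic2 (W x)" for x y
      using torus_even_periodic[OF even] cos_per[of a x "of_int b * y"] cos_per[of b _ "of_int a * x"] cos_per
      by (auto simp: periodic2_def W_def add.commute)
    have const: "integral {0..2} (\<lambda>t. W (x + t * p) (y + t * q)) = 0"
      if "of_int a * p + of_int b * q = 0" "integral {0..2} (\<lambda>t. G (x + t * p, y + t * q)) = 0" for p q x y
    proof -
      have "of_int a * (x + t * p) + of_int b * (y + t * q) = of_int a * x + of_int b * y" for t
      proof -
        have "of_int a * (x + t * p) + of_int b * (y + t * q)
            = of_int a * x + of_int b * y + t * (of_int a * p + of_int b * q)"
          by (simp add: algebra_simps)
        then show ?thesis using that(1) by simp
      qed
      then show ?thesis using that(2) by (simp add: W_def)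
    qed
    have "\<exists>p q. \<forall>x y. integral {0..2} (\<lambda>t. W (x + t * p) (y + t * q)) = 0"
    proof -
      consider "a = 0" | "b = 0" | "a \<noteq> 0" "b \<noteq> 0" by blast
      then show ?thesis
      proof cases
        case 1
        then show ?thesis using const[of 1 0] horizontal by (intro exI[of _ 1] exI[of _ 0]) auto
      next
        case 2
        then show ?thesis using const[of 0 1] vertical by (intro exI[of _ 0] exI[of _ 1]) auto
      next
        case 3
        define p q where "p = b div gcd a b" and "q = - (a div gcd a b)"
        have "coprime p q" using div_gcd_coprime[of a b] 3 by (simp add: p_def q_def coprime_commute)
        moreover have "p \<noteq> 0" "q \<noteq> 0" using 3 by (auto simp: p_def q_def dvd_div_eq_0_iff)
        moreover have "a * p + b * q = 0"
          by (simp add: p_def q_def div_mult_swap mult.commute)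
        then have "of_int a * of_int p + of_int b * of_int q = (0::real)"
          by (metis of_int_0 of_int_add of_int_mult)
        ultimately show ?thesis
          using const[of "of_int p" "of_int q"] oblique by blast
      qed
    qed
    then obtain p q where "\<And>x y. integral {0..2} (\<lambda>t. W (x + t * p) (y + t * q)) = 0" by blast
    from double_integral_eq_0_if_lines[OF contW per this]
    have "integral {0..2} (\<lambda>x. integral {0..2} (W x)) = 0" .
    moreover have "integral ?Q (\<lambda>(x, y). W x y) = integral {0..2} (\<lambda>x. integral {0..2} (W x))"
      using integral_prod_continuous[OF continuous_on_subset[OF contW], of 0 0 2 2] by simp
    ultimately show ?thesis by (simp add: W_def case_prod_unfold)
  qed
  have int: "(\<lambda>z. G z * h z) integrable_on ?Q" if "continuous_on ?Q h" for h
    by (intro integrable_continuous continuous_intros contS that)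
  have orth: "integral ?Q (\<lambda>z. G z * g z) = 0" if "g \<in> cosine_sums" for g
    using that
  proof (induction rule: cosine_sums.induct)
    case (cos_cos a b)
    let ?c = "\<lambda>a b z. cos (pi * (of_int a * fst z + of_int b * snd z)) :: real"
    have "(\<lambda>z. G z * (cos (pi * (of_int a * fst z)) * cos (pi * (of_int b * snd z))))
        = (\<lambda>z. (G z * ?c a b z) * (1/2) + (G z * ?c a (- b) z) * (1/2))"
      by (simp add: fun_eq_iff algebra_simps cos_add cos_diff)
    moreover have "integral ?Q (\<lambda>z. (G z * ?c a b z) * (1/2) + (G z * ?c a (- b) z) * (1/2)) = 0"
      using character[of a b] character[of a "- b"]
      by (subst integral_add) (auto intro!: integrable_on_mult_left int continuous_intros)
    ultimately show ?case by simp
  next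
    case (add g h)
    then show ?case
      by (simp add: distrib_left integral_add int continuous_on_cosine_sums)
  next
    case (scale g c)
    then show ?case by (simp add: mult.left_commute)
  qed
  have "integral ?Q (\<lambda>z. G z * G z) \<le> 0"
  proof (rule field_le_epsilon)
    fix e :: real assume "0 < e"
    define M where "M = integral ?Q (\<lambda>z. \<bar>G z\<bar>)"
    have "0 \<le> M" unfolding M_def by (intro integral_nonneg integrable_continuous continuous_intros contS) auto
    define d where "d = e / (M + 1)"
    have "0 < d" using \<open>0 < e\<close> \<open>0 \<le> M\<close> by (simp add: d_def)
    obtain g where g: "g \<in> cosine_sums" "\<And>z. z \<in> cbox (0, 0) (1, 1) \<Longrightarrow> \<bar>G z - g z\<bar> < d"
      using cosine_sums_dense[OF contS \<open>0 < d\<close>] by blast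
    have close: "\<bar>G z - g z\<bar> < d" for z
    proof (cases z)
      case (Pair x y)
      have "(zigzag x, zigzag y) \<in> cbox (0, 0) (1, 1)"
        by (simp add: cbox_Pair_eq zigzag_nonneg zigzag_le_1)
      then show ?thesis
        using g(2) even torus_even_cosine_sums[OF g(1)] unfolding Pair torus_even_def by metis
    qed
    have cg: "continuous_on S g" for S by (rule continuous_on_cosine_sums[OF g(1)])
    have "integral ?Q (\<lambda>z. G z * G z) = integral ?Q (\<lambda>z. G z * G z) - integral ?Q (\<lambda>z. G z * g z)"
      by (simp add: orth g(1))
    also have "\<dots> = integral ?Q (\<lambda>z. G z * G z - G z * g z)"
      by (intro integral_diff[symmetric] int contS cg)
    also have "\<dots> \<le> integral ?Q (\<lambda>z. \<bar>G z\<bar> * d)"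
    proof (rule integral_le)
      fix z
      have "G z * G z - G z * g z \<le> \<bar>G z\<bar> * \<bar>G z - g z\<bar>"
        by (metis abs_ge_self abs_mult right_diff_distrib)
      also have "\<dots> \<le> \<bar>G z\<bar> * d" using close[of z] by (intro mult_left_mono) auto
      finally show "G z * G z - G z * g z \<le> \<bar>G z\<bar> * d" .
    qed (auto intro!: integrable_continuous continuous_intros contS cg)
    also have "\<dots> = M * d" by (simp add: M_def)
    also have "\<dots> \<le> 0 + e" using \<open>0 \<le> M\<close> \<open>0 < e\<close> by (simp add: d_def field_simps)
    finally show "integral ?Q (\<lambda>z. G z * G z) \<le> 0 + e" .
  qed
  moreover have "0 \<le> integral ?Q (\<lambda>z. G z * G z)"
    by (intro integral_nonneg int contS) auto
  ultimately have "integral ?Q (\<lambda>z. G z * G z) = 0" by simp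
  then have 0: "G w = 0" if "w \<in> ?Q" for w
  proof -
    have "(1, 1) \<in> box (0, 0) (2 :: real, 2 :: real)"
      by (simp add: mem_box Basis_prod_def ball_Un)
    then have "box (0, 0) (2, 2) \<noteq> ({} :: (real \<times> real) set)" by blast
    from integral_cbox_eq_0_iff[OF _ this, of "\<lambda>z. G z * G z"]
    have "integral ?Q (\<lambda>z. G z * G z) = 0 \<longleftrightarrow> (\<forall>z\<in>?Q. G z * G z = 0)"
      by (simp add: continuous_on_mult contS)
    then show ?thesis using \<open>integral ?Q (\<lambda>z. G z * G z) = 0\<close> that by simp
  qed
  obtain x y where "z = (x, y)" by fastforce
  moreover have "zigzag t \<le> 2" for t using zigzag_le_1[of t] by simp
  then have "(zigzag x, zigzag y) \<in> ?Q" by (simp add: cbox_Pair_eq zigzag_nonneg)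
  ultimately show ?thesis using 0 even unfolding torus_even_def by metis
qed

section \<open>Integrals over traces of billiard trajectories\<close>

text \<open>
  The pieces of the trajectory are indexed by the unit cells of the integer lattice that the
  unfolded line traverses: in each cell all coordinates are folded isometrically. The line passes
  from one cell to another only when a coordinate is an integer, hence at countably many times.
\<close>

lemma billiard_set_integral:
  fixes x w :: "real^'n" and f :: "real^'n \<Rightarrow> real"
  assumes w: "norm w = 1" and fixed: "\<And>l. w $ l = 0 \<Longrightarrow> x $ l \<notin> \<int>"
    and N: "countable N" and inj: "inj_on (billiard x w) ({a..b} - N)"
    and f: "continuous_on unit_cube f"
  shows "(LINT z:billiard x w ` {a..b}|hausdorff1. f z) = integral {a..b} (\<lambda>t. f (billiard x w t))"
proof -
  define P where "P m = {a..b} \<inter> (\<Inter>l. {t. of_int (m l) \<le> x $ l + t * w $ l} \<inter>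
      {t. x $ l + t * w $ l \<le> of_int (m l) + 1})" for m :: "'n \<Rightarrow> int"
  define Z where "Z = range (\<lambda>(l, k :: int). (of_int k - x $ l) / w $ l)"
  have hit: "t \<in> Z" if "x $ l + t * w $ l = of_int k" for t l k
  proof -
    have "w $ l \<noteq> 0" using fixed[of l] that by auto
    then have "t = (of_int k - x $ l) / w $ l" using that by (simp add: field_simps)
    then show ?thesis unfolding Z_def by (auto intro: range_eqI[of _ _ "(l, k)"])
  qed
  show ?thesis
  proof (rule set_integral_hausdorff1_curve[where P = P and N = "N \<union> Z"])
    show "continuous_on UNIV (billiard x w)" by (rule continuous_on_billiard)
    show "{a..b} = (\<Union>m. P m)"
    proof
      show "{a..b} \<subseteq> (\<Union>m. P m)"
      proof
        fix t assume "t \<in> {a..b}"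
        then have "t \<in> P (\<lambda>l. \<lfloor>x $ l + t * w $ l\<rfloor>)"
          by (auto simp: P_def intro: less_imp_le floor_less_iff[THEN iffD1] real_of_int_floor_add_one_ge)
        then show "t \<in> (\<Union>m. P m)" by blast
      qed
    qed (auto simp: P_def)
    show "closed (P m)" for m
      unfolding P_def by (intro closed_Int closed_INT closed_Collect_le closed_atLeastAtMost ballI continuous_intros)
    show "dist (billiard x w s) (billiard x w t) = dist s t" if "s \<in> P m" "t \<in> P m" for m s t
    proof -
      have "\<bar>zigzag (x $ l + s * w $ l) - zigzag (x $ l + t * w $ l)\<bar> = \<bar>(s - t) * w $ l\<bar>" for l
        using zigzag_isometric[of "m l" "x $ l + s * w $ l" "x $ l + t * w $ l"] that
        by (auto simp: P_def algebra_simps)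
      then have "norm (billiard x w s - billiard x w t) = norm ((s - t) *\<^sub>R w)"
        by (intro norm_eq_if_abs_components_eq) simp
      then show ?thesis using w by (simp add: dist_norm)
    qed
    show "countable (N \<union> Z)" using N by (simp add: Z_def)
    show "inj_on (billiard x w) ({a..b} - (N \<union> Z))" using inj by (rule inj_on_subset) auto
    show "P m \<inter> P m' \<subseteq> N \<union> Z" if "m \<noteq> m'" for m m'
    proof
      fix t assume t: "t \<in> P m \<inter> P m'"
      obtain l where "m l \<noteq> m' l" using \<open>m \<noteq> m'\<close> by blast
      moreover have "of_int (m l) \<le> x $ l + t * w $ l" "x $ l + t * w $ l \<le> of_int (m l) + 1"
        "of_int (m' l) \<le> x $ l + t * w $ l" "x $ l + t * w $ l \<le> of_int (m' l) + 1"
        using t by (auto simp: P_def)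
      ultimately have "x $ l + t * w $ l = of_int (m l) \<or> x $ l + t * w $ l = of_int (m' l)"
        by linarith
      then show "t \<in> N \<union> Z" using hit by blast
    qed
    show "continuous_on (billiard x w ` {a..b}) f"
      using f by (rule continuous_on_subset) (auto simp: billiard_in_unit_cube)
  qed
qed

text \<open>
  One period consists of the two halves during which the unfolded coordinate \<open>i\<close> runs through
  \<open>{- 1..0}\<close> and \<open>{0..1}\<close>. On each of them the trajectory covers its whole trace injectively.
\<close>

lemma billiard_axis_integral:
  fixes x :: "real^'n" and f :: "real^'n \<Rightarrow> real"
  assumes x: "\<And>l. l \<noteq> i \<Longrightarrow> x $ l \<notin> \<int>" and f: "continuous_on unit_cube f"
  defines "\<gamma> \<equiv> billiard x (axis i 1)"
  shows "\<gamma> \<in> periodic_broken_rays"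
    and "integral {0..2} (\<lambda>t. f (\<gamma> t)) = 2 * (LINT z:range \<gamma>|hausdorff1. f z)"
proof -
  have ax: "axis i (1::real) $ l = (if l = i then 1 else 0)" for l :: 'n by (auto simp: axis_def)
  have nax: "norm (axis i (1::real)) = 1" by simp
  have fixed: "x $ l \<notin> \<int>" if "axis i (1::real) $ l = 0" for l
    using x[of l] that by (auto simp: ax split: if_splits)
  have \<gamma>: "\<gamma> t $ l = zigzag (x $ l + (if l = i then t else 0))" for t l
    by (simp add: \<gamma>_def ax)
  show "\<gamma> \<in> periodic_broken_rays"
    unfolding \<gamma>_def
  proof (rule billiard_periodic_broken_ray[OF nax, of 2])
    show "\<exists>k::int. 2 * axis i (1::real) $ l = 2 * of_int k" for l
      by (intro exI[of _ "if l = i then 1 else 0"]) (simp add: ax)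
    show "k = j" if "x $ k + t * axis i 1 $ k \<in> \<int>" "x $ j + t * axis i 1 $ j \<in> \<int>" for t k j
      using that x[of k] x[of j] by (auto simp: ax split: if_splits)
  qed (use fixed in auto)
  have zigzag_small: "zigzag u = \<bar>u\<bar>" if "\<bar>u\<bar> \<le> 1" for u
    using zigzag_eq_abs[of u 0] that by simp
  \<comment> \<open>The sign \<open>\<sigma>\<close> is the slope of the zigzag map on \<open>{a..a + 1}\<close>; both \<open>a = - 1\<close> and \<open>a = 0\<close> occur below.\<close>
  have half: "(LINT z:range \<gamma>|hausdorff1. f z) = integral {a - x $ i..a + 1 - x $ i} (\<lambda>t. f (\<gamma> t))"
    if sg: "\<And>u. a \<le> u \<Longrightarrow> u \<le> a + 1 \<Longrightarrow> zigzag u = \<sigma> * u" "\<And>u. 0 \<le> u \<Longrightarrow> u \<le> 1 \<Longrightarrow> \<sigma> * u \<in> {a..a + 1}"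
      "\<sigma> * \<sigma> = 1" for a \<sigma>
  proof -
    have "range \<gamma> \<subseteq> \<gamma> ` {a - x $ i..a + 1 - x $ i}"
    proof clarify
      fix t
      define s where "s = \<sigma> * zigzag (x $ i + t) - x $ i"
      have s: "\<sigma> * zigzag (x $ i + t) \<in> {a..a + 1}"
        using sg(2)[of "zigzag (x $ i + t)"] zigzag_nonneg zigzag_le_1 by blast
      have "zigzag (\<sigma> * zigzag (x $ i + t)) = \<sigma> * \<sigma> * zigzag (x $ i + t)"
        using sg(1)[of "\<sigma> * zigzag (x $ i + t)"] s by simp
      then have "\<gamma> t = \<gamma> s" using sg(3) by (simp add: vec_eq_iff \<gamma> s_def)
      moreover have "s \<in> {a - x $ i..a + 1 - x $ i}" using s by (auto simp: s_def)
      ultimately show "\<gamma> t \<in> \<gamma> ` {a - x $ i..a + 1 - x $ i}" by blast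
    qed
    then have "range \<gamma> = \<gamma> ` {a - x $ i..a + 1 - x $ i}" by blast
    moreover have "inj_on \<gamma> ({a - x $ i..a + 1 - x $ i} - {})"
    proof (rule inj_onI)
      fix s t
      assume st: "s \<in> {a - x $ i..a + 1 - x $ i} - {}" "t \<in> {a - x $ i..a + 1 - x $ i} - {}" "\<gamma> s = \<gamma> t"
      then have "zigzag (x $ i + s) = zigzag (x $ i + t)" using \<gamma>[of s i] \<gamma>[of t i] by simp
      then have "\<sigma> * (x $ i + s) = \<sigma> * (x $ i + t)" using st sg(1)[of "x $ i + s"] sg(1)[of "x $ i + t"] by auto
      then show "s = t" using sg(3) by (auto simp: mult_cancel_left)
    qed
    ultimately show ?thesis
      unfolding \<gamma>_def using billiard_set_integral[OF nax fixed countable_empty _ f] by simp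
  qed
  have cont: "continuous_on S (\<lambda>t. f (\<gamma> t))" for S
    unfolding \<gamma>_def
    by (rule continuous_on_compose2[OF f continuous_on_billiard]) (auto simp: billiard_in_unit_cube)
  have per: "periodic2 (\<lambda>t. f (\<gamma> t))"
  proof -
    have "\<gamma> (t + 2) = \<gamma> t" for t
      by (simp add: vec_eq_iff \<gamma> flip: add.assoc)
    then show ?thesis by (simp add: periodic2_def)
  qed
  have "integral {0..2} (\<lambda>t. f (\<gamma> t)) = integral {0..2} (\<lambda>t. f (\<gamma> (t + (- 1 - x $ i))))"
    using integral_periodic2_shift[OF cont per] by simp
  also have "\<dots> = integral {- 1 - x $ i..1 - x $ i} (\<lambda>t. f (\<gamma> t))"
    using integral_shift_Icc_real[of 0 2 "\<lambda>t. f (\<gamma> t)" "- 1 - x $ i"] by (simp add: o_def add.commute)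
  also have "\<dots> = integral {- 1 - x $ i..0 - x $ i} (\<lambda>t. f (\<gamma> t)) + integral {0 - x $ i..1 - x $ i} (\<lambda>t. f (\<gamma> t))"
    by (intro Henstock_Kurzweil_Integration.integral_combine[symmetric] integrable_continuous_interval cont) auto
  also have "integral {- 1 - x $ i..0 - x $ i} (\<lambda>t. f (\<gamma> t)) = (LINT z:range \<gamma>|hausdorff1. f z)"
    using half[of "- 1" "- 1"] zigzag_small by simp
  also have "integral {0 - x $ i..1 - x $ i} (\<lambda>t. f (\<gamma> t)) = (LINT z:range \<gamma>|hausdorff1. f z)"
    using half[of 0 1] zigzag_small by simp
  finally show "integral {0..2} (\<lambda>t. f (\<gamma> t)) = 2 * (LINT z:range \<gamma>|hausdorff1. f z)" by simp
qed

definition planar :: "'n \<Rightarrow> 'n \<Rightarrow> real \<Rightarrow> real \<Rightarrow> real^'n" where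
  "planar i j u v = (\<chi> l. if l = i then u else if l = j then v else 0)"

lemma norm_planar:
  assumes "i \<noteq> j"
  shows "norm (planar i j u v) = sqrt (u\<^sup>2 + v\<^sup>2)"
proof -
  have "(\<Sum>l\<in>UNIV. (planar i j u v $ l)\<^sup>2) = (\<Sum>l\<in>{i, j}. (planar i j u v $ l)\<^sup>2)"
    by (rule sum.mono_neutral_right) (auto simp: planar_def)
  also have "\<dots> = u\<^sup>2 + v\<^sup>2" using assms by (simp add: planar_def)
  finally show ?thesis by (simp add: norm_vec_def L2_set_def)
qed

text \<open>
  If the trajectory is at the same point at times \<open>s\<close> and \<open>t\<close>, then in each of the coordinates \<open>i\<close>
  and \<open>j\<close> the unfolded positions agree modulo 2 up to a sign. If both signs are positive, \<open>s - t\<close> is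
  a multiple of the period, because \<open>p\<close> and \<open>q\<close> are coprime. If both are negative, both coordinates
  are integers at time \<open>(s + t) / 2\<close>, which the assumption on \<open>q x\<^sub>i - p x\<^sub>j\<close> excludes. Different
  signs determine both \<open>s - t\<close> and \<open>s + t\<close> up to countably many values; these are the transversal
  self-intersections. The assumption on \<open>q x\<^sub>i - p x\<^sub>j\<close> also keeps the trajectory away from the edges.
\<close>

lemma billiard_oblique_integral:
  fixes x :: "real^'n" and f :: "real^'n \<Rightarrow> real" and p q :: int
  assumes ij: "i \<noteq> j" and x: "\<And>l. l \<noteq> i \<Longrightarrow> l \<noteq> j \<Longrightarrow> x $ l \<notin> \<int>"
    and pq: "coprime p q" "p \<noteq> 0" "q \<noteq> 0" and generic: "of_int q * x $ i - of_int p * x $ j \<notin> \<int>"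
    and f: "continuous_on unit_cube f"
  defines "r \<equiv> norm (planar i j (of_int p) (of_int q) :: real^'n)"
  defines "\<gamma> \<equiv> billiard x (planar i j (of_int p / r) (of_int q / r))"
  shows "\<gamma> \<in> periodic_broken_rays"
    and "integral {0..2 * r} (\<lambda>t. f (\<gamma> t)) = (LINT z:range \<gamma>|hausdorff1. f z)"
proof -
  let ?w = "planar i j (of_int p / r) (of_int q / r) :: real^'n"
  have r: "r > 0" using pq ij by (simp add: r_def norm_planar sum_power2_gt_zero_iff)
  have w_nth: "?w $ l = (if l = i then of_int p / r else if l = j then of_int q / r else 0)" for l
    by (simp add: planar_def)
  have "?w = (1 / r) *\<^sub>R planar i j (of_int p) (of_int q)"
    by (simp add: vec_eq_iff planar_def)
  then have w: "norm ?w = 1" using r by (simp add: r_def)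
  have fixed: "x $ l \<notin> \<int>" if "?w $ l = 0" for l
    using that x[of l] pq r by (auto simp: w_nth split: if_splits)
  have no_int: False
    if "x $ i + t * (of_int p / r) = of_int k" "x $ j + t * (of_int q / r) = of_int k'" for t and k k' :: int
  proof -
    have "of_int q * x $ i - of_int p * x $ j
        = of_int q * (x $ i + t * (of_int p / r)) - of_int p * (x $ j + t * (of_int q / r))"
      by (simp add: algebra_simps)
    also have "\<dots> = of_int (q * k - p * k')" unfolding that by simp
    finally show False using generic by (metis Ints_of_int)
  qed
  have per: "\<exists>k::int. 2 * r * ?w $ l = 2 * of_int k" for l
    using r by (intro exI[of _ "if l = i then p else if l = j then q else 0"]) (simp add: w_nth)
  show "\<gamma> \<in> periodic_broken_rays"
    unfolding \<gamma>_def
  proof (rule billiard_periodic_broken_ray[OF w _ per fixed])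
    fix t a b
    assume ab: "x $ a + t * ?w $ a \<in> \<int>" "x $ b + t * ?w $ b \<in> \<int>"
    then have "a \<in> {i, j}" "b \<in> {i, j}" using x[of a] x[of b] by (auto simp: w_nth split: if_splits)
    moreover have "\<not> (x $ i + t * ?w $ i \<in> \<int> \<and> x $ j + t * ?w $ j \<in> \<int>)"
      using no_int[of t] ij by (auto simp: w_nth elim!: Ints_cases)
    ultimately show "a = b" using ab by auto
  qed (use r in auto)
  have shift: "\<gamma> (t + 2 * r * of_int m) = \<gamma> t" for t m
    unfolding \<gamma>_def vec_eq_iff
  proof
    fix l
    obtain k :: int where k: "2 * r * ?w $ l = 2 * of_int k" using per by blast
    have "x $ l + (t + 2 * r * of_int m) * ?w $ l = x $ l + t * ?w $ l + of_int m * (2 * r * ?w $ l)"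
      by (simp add: algebra_simps)
    then have "x $ l + (t + 2 * r * of_int m) * ?w $ l - (x $ l + t * ?w $ l) = 2 * of_int (m * k)"
      unfolding k by simp
    then show "billiard x ?w (t + 2 * r * of_int m) $ l = billiard x ?w t $ l"
      unfolding billiard_nth zigzag_eq_iff by blast
  qed
  have "range \<gamma> \<subseteq> \<gamma> ` {0..2 * r}"
  proof clarify
    fix t
    define m where "m = \<lfloor>t / (2 * r)\<rfloor>"
    have "of_int m \<le> t / (2 * r)" "t / (2 * r) < of_int m + 1" unfolding m_def by linarith+
    then have "t + 2 * r * of_int (- m) \<in> {0..2 * r}" using r by (auto simp: field_simps)
    then show "\<gamma> t \<in> \<gamma> ` {0..2 * r}" using shift[of t "- m"] by (metis imageI)
  qed
  then have range: "range \<gamma> = \<gamma> ` {0..2 * r}" by blast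
  \<comment> \<open>The end point \<open>2 * r\<close> repeats the starting point. The two families are the values of \<open>t\<close> for mixed signs.\<close>
  define N where "N = insert (2 * r) (
      range (\<lambda>(k :: int, k' :: int). (of_int k' - x $ j) * r / of_int q - of_int k * r / of_int p) \<union>
      range (\<lambda>(k :: int, k' :: int). (of_int k - x $ i) * r / of_int p - of_int k' * r / of_int q))"
  have "inj_on \<gamma> ({0..2 * r} - N)"
  proof (rule inj_onI)
    fix s t
    assume s: "s \<in> {0..2 * r} - N" and t: "t \<in> {0..2 * r} - N" and eq: "\<gamma> s = \<gamma> t"
    have "zigzag (x $ i + s * (of_int p / r)) = zigzag (x $ i + t * (of_int p / r))"
      "zigzag (x $ j + s * (of_int q / r)) = zigzag (x $ j + t * (of_int q / r))"
      using arg_cong[OF eq, of "\<lambda>z. z $ i"] arg_cong[OF eq, of "\<lambda>z. z $ j"] ij by (simp_all add: \<gamma>_def w_nth)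
    then obtain k k' :: int where
      k: "x $ i + s * (of_int p / r) - (x $ i + t * (of_int p / r)) = 2 * of_int k \<or>
          x $ i + s * (of_int p / r) + (x $ i + t * (of_int p / r)) = 2 * of_int k" and
      k': "x $ j + s * (of_int q / r) - (x $ j + t * (of_int q / r)) = 2 * of_int k' \<or>
          x $ j + s * (of_int q / r) + (x $ j + t * (of_int q / r)) = 2 * of_int k'"
      unfolding zigzag_eq_iff by blast
    have diff: "s - t = 2 * (of_int m * r / of_int c)"
      if "y + s * (of_int c / r) - (y + t * (of_int c / r)) = 2 * of_int m" "c \<noteq> 0" for y and c m :: int
    proof -
      have "(s - t) * (of_int c / r) = 2 * of_int m" using that(1) by (simp add: left_diff_distrib diff_divide_distrib)
      then have "s - t = 2 * of_int m / (of_int c / r)"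
        by (rule nonzero_eq_divide_eq[THEN iffD2, rotated]) (use r that(2) in simp)
      then show ?thesis by simp
    qed
    have sum: "s + t = 2 * ((of_int m - y) * r / of_int c)"
      if "y + s * (of_int c / r) + (y + t * (of_int c / r)) = 2 * of_int m" "c \<noteq> 0" for y and c m :: int
    proof -
      have "(s + t) * (of_int c / r) = 2 * (of_int m - y)" using that(1) by (simp add: distrib_right add_divide_distrib)
      then have "s + t = 2 * (of_int m - y) / (of_int c / r)"
        by (rule nonzero_eq_divide_eq[THEN iffD2, rotated]) (use r that(2) in simp)
      then show ?thesis by simp
    qed
    from k k' show "s = t"
    proof (elim disjE)
      assume *: "x $ i + s * (of_int p / r) - (x $ i + t * (of_int p / r)) = 2 * of_int k"
        "x $ j + s * (of_int q / r) - (x $ j + t * (of_int q / r)) = 2 * of_int k'"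
      define u where "u = (s - t) / (2 * r)"
      have u: "u * of_int p = of_int k"
        unfolding u_def diff[OF *(1) pq(2)] using r pq(2) by simp
      have u': "u * of_int q = of_int k'"
        unfolding u_def diff[OF *(2) pq(3)] using r pq(3) by simp
      obtain a b where ab: "a * p + b * q = 1" using pq(1) bezout_int[of p q] by auto
      have "u = u * of_int (a * p + b * q)" unfolding ab by simp
      also have "\<dots> = of_int a * (u * of_int p) + of_int b * (u * of_int q)" by (simp add: algebra_simps)
      also have "\<dots> = of_int (a * k + b * k')" unfolding u u' by simp
      finally obtain m :: int where m: "u = of_int m" by blast
      have "s < 2 * r" "t < 2 * r" "0 \<le> s" "0 \<le> t"
        using s t by (auto simp: N_def order_less_le)
      then have "\<bar>u\<bar> < 1" using r by (auto simp: u_def abs_less_iff field_simps)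
      then have "u = 0" using m by auto
      then show "s = t" using r by (simp add: u_def)
    next
      assume *: "x $ i + s * (of_int p / r) - (x $ i + t * (of_int p / r)) = 2 * of_int k"
        "x $ j + s * (of_int q / r) + (x $ j + t * (of_int q / r)) = 2 * of_int k'"
      have "t = (of_int k' - x $ j) * r / of_int q - of_int k * r / of_int p"
        using diff[OF *(1) pq(2)] sum[OF *(2) pq(3)] by linarith
      then have "t \<in> N" unfolding N_def by (auto intro: range_eqI[of _ _ "(k, k')"])
      then show "s = t" using t by blast
    next
      assume *: "x $ i + s * (of_int p / r) + (x $ i + t * (of_int p / r)) = 2 * of_int k"
        "x $ j + s * (of_int q / r) - (x $ j + t * (of_int q / r)) = 2 * of_int k'"
      have "t = (of_int k - x $ i) * r / of_int p - of_int k' * r / of_int q"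
        using sum[OF *(1) pq(2)] diff[OF *(2) pq(3)] by linarith
      then have "t \<in> N" unfolding N_def by (auto intro: range_eqI[of _ _ "(k, k')"])
      then show "s = t" using t by blast
    next
      assume *: "x $ i + s * (of_int p / r) + (x $ i + t * (of_int p / r)) = 2 * of_int k"
        "x $ j + s * (of_int q / r) + (x $ j + t * (of_int q / r)) = 2 * of_int k'"
      have False
      proof (rule no_int)
        show "x $ i + (s + t) / 2 * (of_int p / r) = of_int k"
          unfolding sum[OF *(1) pq(2)] using r pq(2) by simp
        show "x $ j + (s + t) / 2 * (of_int q / r) = of_int k'"
          unfolding sum[OF *(2) pq(3)] using r pq(3) by simp
      qed
      then show "s = t" ..
    qed
  qed
  moreover have "countable N" by (simp add: N_def)
  ultimately show "integral {0..2 * r} (\<lambda>t. f (\<gamma> t)) = (LINT z:range \<gamma>|hausdorff1. f z)"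
    unfolding range unfolding \<gamma>_def using billiard_set_integral[OF w fixed _ _ f] by simp
qed

section \<open>Injectivity of the transform\<close>

definition slice :: "real^'n \<Rightarrow> 'n \<Rightarrow> 'n \<Rightarrow> real \<times> real \<Rightarrow> real^'n" where
  "slice z i j u = (\<chi> l. if l = i then zigzag (fst u) else if l = j then zigzag (snd u) else z $ l)"

text \<open>
  Translating the line orthogonally to its direction changes \<open>Q a - P b\<close> at a nonzero rate. So the
  lines with a noninteger value accumulate at every line, and the line integral depends
  continuously on the translation.
\<close>

lemma line_integral_eq_0_if_generic:
  fixes G :: "real \<times> real \<Rightarrow> real" and P Q :: real
  assumes cont: "continuous_on UNIV G" and nz: "P \<noteq> 0 \<or> Q \<noteq> 0"
    and generic: "\<And>a b. Q * a - P * b \<notin> \<int> \<Longrightarrow> integral {0..2} (\<lambda>t. G (a + t * P, b + t * Q)) = 0"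
  shows "integral {0..2} (\<lambda>t. G (a + t * P, b + t * Q)) = 0"
proof -
  define g where "g \<delta> = integral {0..2} (\<lambda>t. G (a + \<delta> * Q + t * P, b - \<delta> * P + t * Q))" for \<delta>
  define c d e where "c = Q * a - P * b" and "d = Q\<^sup>2 + P\<^sup>2" and "e = (of_int \<lfloor>c\<rfloor> + 1 - c) / d"
  have "d > 0" using nz by (auto simp: d_def sum_power2_gt_zero_iff)
  have "c < of_int \<lfloor>c\<rfloor> + 1" by linarith
  then have "0 < e" using \<open>d > 0\<close> by (simp add: e_def)
  have "continuous_on (UNIV \<times> cbox 0 2) (\<lambda>(\<delta>, t). G (a + \<delta> * Q + t * P, b - \<delta> * P + t * Q))"
    unfolding case_prod_unfold by (rule continuous_on_compose2[OF cont]) (auto intro!: continuous_intros)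
  from integral_continuous_on_param[OF this] have "continuous_on UNIV g" by (simp add: g_def)
  then have cont_g: "continuous_on (closure {0<..<e}) g" by (rule continuous_on_subset) simp
  have "g \<delta> = 0" if "\<delta> \<in> {0<..<e}" for \<delta>
    unfolding g_def
  proof (rule generic)
    have "c < c + \<delta> * d" "c + \<delta> * d < of_int \<lfloor>c\<rfloor> + 1"
      using that \<open>d > 0\<close> by (auto simp: e_def field_simps)
    then have "of_int \<lfloor>c\<rfloor> < c + \<delta> * d" "c + \<delta> * d < of_int (\<lfloor>c\<rfloor> + 1)"
      by linarith+
    then have "c + \<delta> * d \<notin> \<int>" by (auto elim!: Ints_cases)
    then show "Q * (a + \<delta> * Q) - P * (b - \<delta> * P) \<notin> \<int>"
      by (simp add: c_def d_def algebra_simps power2_eq_square)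
  qed
  from continuous_constant_on_closure[OF cont_g this] have "g 0 = 0" using \<open>0 < e\<close> by simp
  then show ?thesis by (simp add: g_def)
qed

text \<open>
  At an interior point \<open>z\<close> the coordinates other than \<open>i\<close> and \<open>j\<close> are kept fixed. The restriction of
  \<open>h\<close> to this slice, unfolded in the coordinates \<open>i\<close> and \<open>j\<close>, has vanishing line integrals in all
  integer directions.
\<close>

lemma continuous_eq_0_if_rays:
  fixes h :: "real^'n \<Rightarrow> real"
  assumes ij: "i \<noteq> j" and h: "continuous_on unit_cube h"
    and axis: "\<And>x k. (\<And>l. l \<noteq> k \<Longrightarrow> x $ l \<notin> \<int>) \<Longrightarrow>
      integral {0..2} (\<lambda>t. h (billiard x (axis k 1) t)) = 0"
    and oblique: "\<And>x p q r. (\<And>l. l \<noteq> i \<Longrightarrow> l \<noteq> j \<Longrightarrow> x $ l \<notin> \<int>) \<Longrightarrow> coprime p q \<Longrightarrow>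
      p \<noteq> 0 \<Longrightarrow> q \<noteq> 0 \<Longrightarrow> of_int q * x $ i - of_int p * x $ j \<notin> \<int> \<Longrightarrow>
      r = norm (planar i j (of_int p) (of_int q) :: real^'n) \<Longrightarrow>
      integral {0..2 * r} (\<lambda>t. h (billiard x (planar i j (of_int p / r) (of_int q / r)) t)) = 0"
    and z: "z \<in> unit_cube"
  shows "h z = 0"
proof -
  have int0: "h z = 0" if z: "z \<in> interior unit_cube" for z
  proof -
    have z01: "0 < z $ l" "z $ l < 1" for l
      using z by (auto simp: unit_cube_def interior_cbox mem_box_cart)
    have zint: "z $ l \<notin> \<int>" for l using z01[of l] by (auto elim!: Ints_cases)
    define base where "base a b = (\<chi> l. if l = i then a else if l = j then b else z $ l)" for a b
    define G where "G u = h (slice z i j u)" for u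
    have bil: "h (billiard (base a b) w t) = G (a + t * w $ i, b + t * w $ j)"
      if "\<And>l. l \<noteq> i \<Longrightarrow> l \<noteq> j \<Longrightarrow> w $ l = 0" for a b w t
    proof -
      have "billiard (base a b) w t = slice z i j (a + t * w $ i, b + t * w $ j)"
        using that z01 by (simp add: vec_eq_iff slice_def base_def zigzag_id less_imp_le)
      then show ?thesis by (simp add: G_def)
    qed
    have slice: "slice z i j u \<in> unit_cube" for u
      using z01 by (simp add: unit_cube_def mem_box_cart slice_def zigzag_nonneg zigzag_le_1 less_imp_le)
    have contG: "continuous_on S G" for S
    proof -
      have "continuous_on S (\<lambda>u. slice z i j u)"
        unfolding slice_def
      proof (rule continuous_on_vec_lambda)
        show "continuous_on S (\<lambda>u. if l = i then zigzag (fst u) else if l = j then zigzag (snd u) else z $ l)" for l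
          by (cases "l = i"; cases "l = j") (auto intro!: continuous_intros)
      qed
      then show ?thesis unfolding G_def by (rule continuous_on_compose2[OF h]) (use slice in auto)
    qed
    have even: "torus_even G"
      unfolding torus_even_def G_def slice_def by (simp add: zigzag_id zigzag_nonneg zigzag_le_1 cong: if_cong)
    have "G (z $ i, z $ j) = 0"
    proof (rule torus_even_eq_0_if_lines[OF contG even])
      fix a b :: real
      show "integral {0..2} (\<lambda>t. G (a + t * of_int p, b + t * of_int q)) = 0"
        if pq: "coprime p q" "p \<noteq> 0" "q \<noteq> 0" for p q :: int
      proof -
        define r where "r = norm (planar i j (of_int p) (of_int q) :: real^'n)"
        have r: "r > 0" using pq ij by (simp add: r_def norm_planar sum_power2_gt_zero_iff)
        have gen: "integral {0..2} (\<lambda>t. G (a + t * of_int p, b + t * of_int q)) = 0"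
          if "of_int q * a - of_int p * b \<notin> \<int>" for a b
        proof -
          let ?\<gamma> = "billiard (base a b) (planar i j (of_int p / r) (of_int q / r))"
          have "integral {0..2 * r} (\<lambda>t. h (?\<gamma> t)) = 0"
            by (rule oblique[OF _ pq _ r_def]) (use ij that zint in \<open>auto simp: base_def\<close>)
          moreover have "h (?\<gamma> t) = G (a + t * (of_int p / r), b + t * (of_int q / r))" for t
            using ij by (subst bil) (auto simp: planar_def)
          ultimately have "integral {0..2 * r} (\<lambda>t. G (a + t * (of_int p / r), b + t * (of_int q / r))) = 0"
            by simp
          \<comment> \<open>Passage from arc length to the parametrisation with velocity \<open>(p, q)\<close>.\<close>
          moreover have "integral ((\<lambda>t. t / r) ` {0..2 * r}) (\<lambda>t. G (a + r * t * (of_int p / r), b + r * t * (of_int q / r)))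
              = (1 / \<bar>r\<bar>) *\<^sub>R integral {0..2 * r} (\<lambda>t. G (a + t * (of_int p / r), b + t * (of_int q / r)))"
            using r by (intro integral_stretch_real) auto
          moreover have "(\<lambda>t. t / r) ` {0..2 * r} = {0..2}"
            using r by (simp add: image_divide_atLeastAtMost)
          ultimately show ?thesis using r by simp
        qed
        show ?thesis
          by (rule line_integral_eq_0_if_generic[OF contG _ gen]) (use pq in auto)
      qed
      show "integral {0..2} (\<lambda>t. G (a + t, b)) = 0"
      proof -
        have "integral {0..2} (\<lambda>t. G (a + t * 1, b + t * 0)) = 0" if "0 * a - 1 * b \<notin> \<int>" for a b
        proof -
          have "integral {0..2} (\<lambda>t. h (billiard (base a b) (axis i 1) t)) = 0"
            by (rule axis) (use that zint in \<open>auto simp: base_def\<close>)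
          moreover have "h (billiard (base a b) (axis i 1) t) = G (a + t * 1, b + t * 0)" for t
            using ij by (subst bil) (auto simp: axis_def)
          ultimately show ?thesis by simp
        qed
        from line_integral_eq_0_if_generic[OF contG _ this] show ?thesis by simp
      qed
      show "integral {0..2} (\<lambda>t. G (a, b + t)) = 0"
      proof -
        have "integral {0..2} (\<lambda>t. G (a + t * 0, b + t * 1)) = 0" if "1 * a - 0 * b \<notin> \<int>" for a b
        proof -
          have "integral {0..2} (\<lambda>t. h (billiard (base a b) (axis j 1) t)) = 0"
            by (rule axis) (use that zint in \<open>auto simp: base_def\<close>)
          moreover have "h (billiard (base a b) (axis j 1) t) = G (a + t * 0, b + t * 1)" for t
            using ij by (subst bil) (auto simp: axis_def)
          ultimately show ?thesis by simp
        qed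
        from line_integral_eq_0_if_generic[OF contG _ this] show ?thesis by simp
      qed
    qed
    moreover have "slice z i j (z $ i, z $ j) = z"
      using z01 by (simp add: vec_eq_iff slice_def zigzag_id less_imp_le)
    ultimately show ?thesis by (simp add: G_def)
  qed
  have closure: "closure (interior (unit_cube :: (real^'n) set)) = unit_cube"
  proof -
    have "(\<chi> l. 1 / 2) \<in> interior (unit_cube :: (real^'n) set)"
      by (simp add: unit_cube_def interior_cbox mem_box_cart)
    then have "interior (unit_cube :: (real^'n) set) \<noteq> {}" by blast
    then show ?thesis
      by (simp add: unit_cube_def convex_closure_interior convex_box)
  qed
  show ?thesis
    by (rule continuous_constant_on_closure[of "interior unit_cube" h]) (use h int0 z closure in auto)
qed

lemma Ck_on_imp_continuous_on: "Ck_on k S f \<Longrightarrow> continuous_on S f"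
  by (cases k) (auto intro: differentiable_imp_continuous_on)

theorem proposition31:
  assumes "CARD('n::finite) \<ge> 2"
  shows "inj_on periodic_broken_ray_transform
    {f :: real^'n \<Rightarrow> real. f \<in> extensional unit_cube \<and> Ck_on CARD('n) unit_cube f \<and>
       even_at CARD('n) (frontier unit_cube) f}"
proof (rule inj_onI)
  fix f g :: "real^'n \<Rightarrow> real"
  assume "f \<in> {f. f \<in> extensional unit_cube \<and> Ck_on CARD('n) unit_cube f \<and>
       even_at CARD('n) (frontier unit_cube) f}"
    and "g \<in> {f. f \<in> extensional unit_cube \<and> Ck_on CARD('n) unit_cube f \<and>
       even_at CARD('n) (frontier unit_cube) f}"
    and same: "periodic_broken_ray_transform f = periodic_broken_ray_transform g"
  then have ext: "f \<in> extensional unit_cube" "g \<in> extensional unit_cube"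
    and cont: "continuous_on unit_cube f" "continuous_on unit_cube g"
    by (auto intro: Ck_on_imp_continuous_on)
  obtain i j :: 'n where ij: "i \<noteq> j"
    using assms card_le_Suc0_iff_eq[of "UNIV :: 'n set"] by (auto simp: not_less_eq_eq numeral_2_eq_2)
  have rays: "(LINT z:range \<gamma>|hausdorff1. f z) = (LINT z:range \<gamma>|hausdorff1. g z)"
    if "\<gamma> \<in> periodic_broken_rays" for \<gamma>
    using fun_cong[OF same, of \<gamma>] that by (simp add: periodic_broken_ray_transform_def)
  have diff: "integral {a..b} (\<lambda>t. f (billiard x w t) - g (billiard x w t)) =
      integral {a..b} (\<lambda>t. f (billiard x w t)) - integral {a..b} (\<lambda>t. g (billiard x w t))" for a b x w
    by (intro integral_diff integrable_continuous_interval)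
      (auto intro!: continuous_on_compose2[OF cont(1)] continuous_on_compose2[OF cont(2)]
        continuous_on_billiard billiard_in_unit_cube)
  have "f z - g z = 0" if "z \<in> unit_cube" for z
  proof (rule continuous_eq_0_if_rays[OF ij _ _ _ that])
    show "continuous_on unit_cube (\<lambda>z. f z - g z)" using cont by (intro continuous_intros)
    show "integral {0..2} (\<lambda>t. f (billiard x (axis k 1) t) - g (billiard x (axis k 1) t)) = 0"
      if "\<And>l. l \<noteq> k \<Longrightarrow> x $ l \<notin> \<int>" for x k
      using billiard_axis_integral[of k x, OF that cont(1)] billiard_axis_integral(2)[of k x, OF that cont(2)]
      by (simp add: diff rays)
    show "integral {0..2 * r} (\<lambda>t. f (billiard x (planar i j (of_int p / r) (of_int q / r)) t)
        - g (billiard x (planar i j (of_int p / r) (of_int q / r)) t)) = 0"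
      if x: "\<And>l. l \<noteq> i \<Longrightarrow> l \<noteq> j \<Longrightarrow> x $ l \<notin> \<int>" and pq: "coprime p q" "p \<noteq> 0" "q \<noteq> 0"
        "of_int q * x $ i - of_int p * x $ j \<notin> \<int>"
        and r: "r = norm (planar i j (of_int p) (of_int q) :: real^'n)" for x p q r
      unfolding r
      using billiard_oblique_integral[OF ij x pq cont(1)] billiard_oblique_integral(2)[OF ij x pq cont(2)]
      by (simp add: diff rays)
  qed
  then show "f = g" by (intro extensionalityI[OF ext]) auto
qed

end
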